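(* (i) There exist infinitely many bipartite $2$-planar (simple) graphs $G$ such that, with $n$ the number of vertices of $G$, $G$ has exactly $3.5n-12$ edges. (ii) There exist infinitely many bipartite $2$-planar multigraphs $G$ such that, with $n$ the number of vertices of $G$, $G$ has exactly $3.5n-8$ edges.
   Context: A topological drawing places vertices at distinct points and edges as Jordan arcs between their endpoints, such that no edge passes through a vertex other than its endpoints, no two adjacent edges cross, no edge crosses itself, no two edges meet tangentially, and any two edges cross at most once. A multigraph may have parallel edges (no loops), but no homotopic edges: every region (bounded or unbounded) delimited by two parallel edges contains at least one vertex in its interior. A (multi)graph is $2$-planar if it admits such a drawing in which every edge is crossed at most twice. *)

theory Defs
  imports "HOL-Analysis.Analysis"
begin

text \<open>Undirected multigraphs; edges are named, so several edges may have the same pair of ends.\<close>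

record ('v, 'e) multigraph =
  verts :: "'v set"
  edges :: "'e set"
  ends :: "'e \<Rightarrow> 'v set"

definition multigraph :: "('v, 'e) multigraph \<Rightarrow> bool" where
  "multigraph G \<longleftrightarrow> finite (verts G) \<and> finite (edges G) \<and>
     (\<forall>e\<in>edges G. ends G e \<subseteq> verts G \<and> card (ends G e) = 2)"

definition simple_graph :: "('v, 'e) multigraph \<Rightarrow> bool" where
  "simple_graph G \<longleftrightarrow> multigraph G \<and> inj_on (ends G) (edges G)"

definition bipartite :: "('v, 'e) multigraph \<Rightarrow> bool" where
  "bipartite G \<longleftrightarrow> (\<exists>A B. verts G = A \<union> B \<and> A \<inter> B = {} \<and>
     (\<forall>e\<in>edges G. \<exists>a\<in>A. \<exists>b\<in>B. ends G e = {a, b}))"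

definition isomorphic :: "('v, 'e) multigraph \<Rightarrow> ('w, 'f) multigraph \<Rightarrow> bool" where
  "isomorphic G H \<longleftrightarrow> (\<exists>\<phi> \<psi>. bij_betw \<phi> (verts G) (verts H) \<and> bij_betw \<psi> (edges G) (edges H) \<and>
     (\<forall>e\<in>edges G. ends H (\<psi> e) = \<phi> ` ends G e))"

definition relative_interior_arc :: "(real \<Rightarrow> complex) \<Rightarrow> complex set" where
  "relative_interior_arc g = path_image g - {pathstart g, pathfinish g}"

text \<open>Two arcs cross (as opposed to touching tangentially) at a common interior point \<open>p\<close> if, up to a homeomorphism of
  a neighbourhood of \<open>p\<close>, they look like the two coordinate axes at the origin.\<close>

definition crosses_at :: "(real \<Rightarrow> complex) \<Rightarrow> (real \<Rightarrow> complex) \<Rightarrow> complex \<Rightarrow> bool" where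
  "crosses_at g h p \<longleftrightarrow> p \<in> relative_interior_arc g \<inter> relative_interior_arc h \<and>
     (\<exists>U \<phi> \<psi>. open U \<and> p \<in> U \<and> homeomorphism U (ball (0::complex) 1) \<phi> \<psi> \<and> \<phi> p = 0 \<and>
     \<phi> ` (U \<inter> path_image g) = {z \<in> ball 0 1. Im z = 0} \<and>
     \<phi> ` (U \<inter> path_image h) = {z \<in> ball 0 1. Re z = 0})"

definition topological_drawing ::
    "('v, 'e) multigraph \<Rightarrow> ('v \<Rightarrow> complex) \<Rightarrow> ('e \<Rightarrow> real \<Rightarrow> complex) \<Rightarrow> bool" where
  "topological_drawing G pos \<gamma> \<longleftrightarrow>
     inj_on pos (verts G) \<and>
     (\<forall>e\<in>edges G. arc (\<gamma> e) \<and> {pathstart (\<gamma> e), pathfinish (\<gamma> e)} = pos ` ends G e) \<and>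
     (\<forall>e\<in>edges G. \<forall>v\<in>verts G. pos v \<in> path_image (\<gamma> e) \<longrightarrow> v \<in> ends G e) \<and>
     (\<forall>e\<in>edges G. \<forall>f\<in>edges G. e \<noteq> f \<longrightarrow>
        (\<forall>p \<in> relative_interior_arc (\<gamma> e) \<inter> relative_interior_arc (\<gamma> f). crosses_at (\<gamma> e) (\<gamma> f) p)) \<and>
     (\<forall>e\<in>edges G. \<forall>f\<in>edges G. e \<noteq> f \<and> ends G e \<inter> ends G f \<noteq> {} \<longrightarrow>
        (\<forall>p. \<not> crosses_at (\<gamma> e) (\<gamma> f) p)) \<and>
     (\<forall>e\<in>edges G. \<forall>f\<in>edges G. e \<noteq> f \<longrightarrow>
        (\<forall>p q. crosses_at (\<gamma> e) (\<gamma> f) p \<and> crosses_at (\<gamma> e) (\<gamma> f) q \<longrightarrow> p = q))"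

text \<open>In a topological drawing two parallel edges form a Jordan curve, and the regions they delimit
  are the two (open) components of its complement.\<close>

definition no_homotopic_edges ::
    "('v, 'e) multigraph \<Rightarrow> ('v \<Rightarrow> complex) \<Rightarrow> ('e \<Rightarrow> real \<Rightarrow> complex) \<Rightarrow> bool" where
  "no_homotopic_edges G pos \<gamma> \<longleftrightarrow>
     (\<forall>e\<in>edges G. \<forall>f\<in>edges G. e \<noteq> f \<and> ends G e = ends G f \<longrightarrow>
        (\<forall>C \<in> components (- (path_image (\<gamma> e) \<union> path_image (\<gamma> f))). \<exists>v\<in>verts G. pos v \<in> C))"

definition crossings :: "('v, 'e) multigraph \<Rightarrow> ('e \<Rightarrow> real \<Rightarrow> complex) \<Rightarrow> 'e \<Rightarrow> ('e \<times> complex) set" where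
  "crossings G \<gamma> e = {(f, p). f \<in> edges G \<and> f \<noteq> e \<and> crosses_at (\<gamma> e) (\<gamma> f) p}"

definition k_planar :: "nat \<Rightarrow> ('v, 'e) multigraph \<Rightarrow> bool" where
  "k_planar k G \<longleftrightarrow> (\<exists>pos \<gamma>. topological_drawing G pos \<gamma> \<and> no_homotopic_edges G pos \<gamma> \<and>
     (\<forall>e\<in>edges G. finite (crossings G \<gamma> e) \<and> card (crossings G \<gamma> e) \<le> k))"

end

theory Submission
  imports Defs
begin

text \<open>Draw an infinite pattern on a cylinder of circumference \<open>4 m\<close>, with \<open>m\<close> vertices on each of the layers
  \<open>0, 1, 2, \<dots>\<close>, coloured periodically black, white, white, black, and with straight edges in the universal cover
  (coordinates \<open>x\<close> around the cylinder and \<open>y\<close> along it); \<open>exp\<close> maps the cylinder onto the punctured plane.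
  Each column of a period has 4 vertices and 14 edges, every edge lies between two consecutive layers divisible
  by 4, and for \<open>m \<ge> 2\<close> the drawing has all required properties. Cutting at the layers \<open>0\<close> and \<open>4 k\<close> leaves
  \<open>n = m (4 k + 1)\<close> vertices and \<open>14 m k = 3.5 n - 3.5 m\<close> edges. For \<open>m = 2\<close> parallel edges wind once around
  the cylinder together, hence are not homotopic, and deleting one edge gives \<open>3.5 n - 8\<close>. For \<open>m = 3\<close> the graph is simple,
  and deleting a vertex of degree 5 on the last layer gives \<open>3.5 n - 12\<close>.\<close>

section \<open>Straight lines on a cylinder\<close>

definition cyl :: "real \<Rightarrow> real \<Rightarrow> real \<Rightarrow> complex" where
  "cyl C x y = exp (Complex y (2 * pi * x / C))"

text \<open>A straight segment in the cover, hence a logarithmic spiral in the plane. The slope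
  \<open>s\<close> is the horizontal advance per unit of height, so vertical segments are
  included.\<close>

definition helix :: "real \<Rightarrow> real \<Rightarrow> real \<Rightarrow> real \<Rightarrow> real \<Rightarrow> real \<Rightarrow> complex" where
  "helix C s x a b t = cyl C (x + s * (t * (b - a))) (a + t * (b - a))"

lemma cyl_eq_iff:
  assumes "C > 0"
  shows "cyl C x y = cyl C x' y' \<longleftrightarrow> y = y' \<and> (\<exists>n::int. x = x' + C * n)"
proof -
  have "2 * pi * x / C = 2 * pi * x' / C + 2 * n * pi \<longleftrightarrow> x = x' + C * n" for n :: int
  proof -
    have "2 * pi * x / C = 2 * pi * x' / C + 2 * n * pi \<longleftrightarrow> (2 * pi / C) * x = (2 * pi / C) * (x' + C * n)"
      using assms by (simp add: field_simps)
    then show ?thesis using assms by simp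
  qed
  then show ?thesis
    unfolding cyl_def exp_eq by (auto simp: complex_eq_iff)
qed

lemma cyl_nonzero: "cyl C x y \<noteq> 0"
  by (simp add: cyl_def)

lemma norm_cyl: "norm (cyl C x y) = exp y"
  by (simp add: cyl_def)

text \<open>Radial motion in the plane is vertical motion on the cylinder.\<close>

lemma scale_cyl: "r > 0 \<Longrightarrow> of_real r * cyl C x y = cyl C x (y + ln r)"
proof -
  assume r: "r > 0"
  have "cyl C x (y + ln r) = exp (Complex y (2 * pi * x / C) + of_real (ln r))"
    unfolding cyl_def by (rule arg_cong[where f=exp]) (simp add: complex_eq_iff)
  also have "\<dots> = of_real r * cyl C x y"
    using r by (simp add: exp_add cyl_def exp_of_real mult.commute)
  finally show ?thesis by simp
qed

text \<open>Any half-open window of one circumference is a fundamental domain. Its start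
  \<open>x0\<close> stays free so that it can be adapted to a given curve.\<close>

lemma nonzero_eq_cyl:
  assumes "C > 0" "z \<noteq> 0"
  obtains x y where "x0 \<le> x" "x < x0 + C" "z = cyl C x y"
proof -
  define t where "t = Im (Ln z) * C / (2 * pi)"
  define n where "n = \<lfloor>(t - x0) / C\<rfloor>"
  have n: "n \<le> (t - x0) / C" "(t - x0) / C < n + 1"
    unfolding n_def by linarith+
  have z: "z = cyl C t (Re (Ln z))"
    using assms exp_Ln[OF assms(2)] by (simp add: cyl_def t_def complex_eq del: exp_Ln Re_Ln)
  have "cyl C t (Re (Ln z)) = cyl C (t - C * n) (Re (Ln z))"
    using assms by (auto simp: cyl_eq_iff intro!: exI[of _ n])
  moreover have "x0 \<le> t - C * n" "t - C * n < x0 + C"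
    using n assms by (simp_all add: field_simps)
  ultimately show ?thesis using that z by metis
qed

lemma continuous_on_cyl [continuous_intros]:
  assumes "continuous_on A f" "continuous_on A g"
  shows "continuous_on A (\<lambda>t. cyl C (f t) (g t))"
  unfolding cyl_def Complex_eq divide_inverse by (intro continuous_intros assms)

section \<open>Arcs of constant slope\<close>

lemma path_image_helix:
  assumes "a < b"
  shows "path_image (helix C s x a b) = (\<lambda>y. cyl C (x + s * (y - a)) y) ` {a..b}"
proof -
  have "(\<lambda>t. a + t * (b - a)) ` {0..1} = {a..b}"
    using image_affinity_atLeastAtMost[of "b - a" a 0 1] assms by (simp add: mult.commute add.commute)
  moreover have "path_image (helix C s x a b) = (\<lambda>y. cyl C (x + s * (y - a)) y) ` ((\<lambda>t. a + t * (b - a)) ` {0..1})"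
    unfolding path_image_def image_image by (simp add: helix_def[abs_def])
  ultimately show ?thesis by simp
qed

lemma cyl_in_path_image_helix:
  assumes "C > 0" "a < b"
  shows "cyl C t y \<in> path_image (helix C s x a b) \<longleftrightarrow> a \<le> y \<and> y \<le> b \<and> (\<exists>n::int. t = x + s * (y - a) + C * n)"
  using assms by (auto simp: path_image_helix image_iff cyl_eq_iff)

lemma pathstart_helix [simp]: "pathstart (helix C s x a b) = cyl C x a"
  by (simp add: pathstart_def helix_def)

lemma pathfinish_helix [simp]: "pathfinish (helix C s x a b) = cyl C (x + s * (b - a)) b"
  by (simp add: pathfinish_def helix_def)

text \<open>The height, and with it the modulus, increases strictly along the curve, which gives
  injectivity.\<close>

lemma arc_helix:
  assumes "C > 0" "a < b"
  shows "arc (helix C s x a b)"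
  unfolding arc_def path_def
proof
  show "continuous_on {0..1} (helix C s x a b)"
    unfolding helix_def[abs_def] by (intro continuous_intros)
  show "inj_on (helix C s x a b) {0..1}"
    using assms by (auto intro!: inj_onI simp: helix_def cyl_eq_iff)
qed

lemma relative_interior_arc_helix:
  assumes "C > 0" "a < b"
  shows "relative_interior_arc (helix C s x a b) = (\<lambda>y. cyl C (x + s * (y - a)) y) ` {a<..<b}"
proof -
  let ?f = "\<lambda>y. cyl C (x + s * (y - a)) y"
  have "inj ?f" using assms by (auto intro!: injI simp: cyl_eq_iff)
  have "relative_interior_arc (helix C s x a b) = ?f ` {a..b} - ?f ` {a, b}"
    using assms by (simp add: relative_interior_arc_def path_image_helix)
  also have "\<dots> = ?f ` ({a..b} - {a, b})"
    using \<open>inj ?f\<close> by (simp add: image_set_diff)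
  also have "{a..b} - {a, b} = {a<..<b}" by auto
  finally show ?thesis .
qed

text \<open>It is easier to parametrise a neighbourhood by the disc than to give a chart on it.
  Invariance of domain turns a continuous injective \<open>\<Psi>\<close> into a homeomorphism onto
  an open set, and its inverse is the chart.\<close>

lemma crosses_at_chart:
  assumes cont: "continuous_on (ball 0 1) \<Psi>" and inj: "inj_on \<Psi> (ball (0::complex) 1)"
    and p: "\<Psi> 0 = p" "p \<in> relative_interior_arc g" "p \<in> relative_interior_arc h"
    and g: "\<And>w. w \<in> ball 0 1 \<Longrightarrow> \<Psi> w \<in> path_image g \<longleftrightarrow> Im w = 0"
    and h: "\<And>w. w \<in> ball 0 1 \<Longrightarrow> \<Psi> w \<in> path_image h \<longleftrightarrow> Re w = 0"
  shows "crosses_at g h p"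
proof -
  let ?B = "ball (0::complex) 1"
  obtain \<phi> where hom: "homeomorphism ?B (\<Psi> ` ?B) \<Psi> \<phi>"
    using invariance_of_domain_homeomorphism[OF open_ball cont _ inj] by auto
  have op: "open (\<Psi> ` ?B)"
    using invariance_of_domain[OF cont open_ball inj] .
  have \<phi>: "\<phi> (\<Psi> w) = w" if "w \<in> ?B" for w
    using hom that by (simp add: homeomorphism_def)
  have im: "\<phi> ` (\<Psi> ` ?B \<inter> S) = {w \<in> ?B. \<Psi> w \<in> S}" for S
  proof -
    have "\<Psi> ` ?B \<inter> S = \<Psi> ` {w \<in> ?B. \<Psi> w \<in> S}" by blast
    also have "\<phi> ` \<dots> = (\<lambda>w. w) ` {w \<in> ?B. \<Psi> w \<in> S}"
      unfolding image_image by (rule image_cong) (use \<phi> in auto)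
    finally show ?thesis by simp
  qed
  have "p \<in> \<Psi> ` ?B" using p(1) by (metis centre_in_ball imageI zero_less_one)
  moreover have "\<phi> p = 0" using p(1) \<phi>[of 0] by simp
  moreover have "\<phi> ` (\<Psi> ` ?B \<inter> path_image g) = {z \<in> ?B. Im z = 0}"
    unfolding im using g by blast
  moreover have "\<phi> ` (\<Psi> ` ?B \<inter> path_image h) = {z \<in> ?B. Re z = 0}"
    unfolding im using h by blast
  moreover note homeomorphism_symD[OF hom] op p
  ultimately show ?thesis unfolding crosses_at_def by blast
qed

text \<open>Two lifts of one point differ by a multiple of \<open>C\<close>; this excludes every
  lift but one from a sufficiently small region.\<close>

lemma abs_int_multiple_less:
  fixes C u :: real and n :: int
  assumes "u = C * n" "\<bar>u\<bar> < C"
  shows "u = 0"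
proof -
  have "C > 0" using assms by linarith
  then have "\<bar>real_of_int n\<bar> < 1" using assms by (simp add: abs_mult)
  then have "n = 0" by linarith
  then show ?thesis using assms by simp
qed

text \<open>Sheared coordinates \<open>w \<mapsto> r \<cdot> (Re w \<cdot> (s, 1) + Im w \<cdot> (s', 1))\<close> on the universal cover, with \<open>r\<close>
  small, straighten both curves; the other lifts of either curve stay out of reach.\<close>

lemma crosses_at_helix:
  assumes C: "C > 0" and y: "a < y" "y < b" "a' < y" "y < b'" and s: "s \<noteq> s'"
    and eq: "cyl C (x + s * (y - a)) y = cyl C (x' + s' * (y - a')) y"
  shows "crosses_at (helix C s x a b) (helix C s' x' a' b') (cyl C (x + s * (y - a)) y)"
proof -
  define \<delta> where "\<delta> = min (min (y - a) (b - y)) (min (y - a') (b' - y))"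
  \<comment> \<open>Inside the disc \<open>\<bar>Re w + Im w\<bar> < 2\<close>. The first bound
    therefore keeps heights within \<open>\<delta>\<close> of \<open>y\<close>, and the second keeps
    horizontal deviations below \<open>C\<close>.\<close>
  define r where "r = min (\<delta> / 3) (C / (3 * \<bar>s - s'\<bar>))"
  have \<delta>: "\<delta> > 0" "\<delta> \<le> y - a" "\<delta> \<le> b - y" "\<delta> \<le> y - a'" "\<delta> \<le> b' - y"
    using y by (auto simp: \<delta>_def)
  have r: "r > 0" "r \<le> \<delta> / 3" "r * \<bar>s - s'\<bar> \<le> C / 3"
  proof -
    show "r > 0" using \<delta> C s by (simp add: r_def)
    show "r \<le> \<delta> / 3" unfolding r_def by (rule min.cobounded1)
    have "r \<le> C / (3 * \<bar>s - s'\<bar>)" by (simp add: r_def)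
    then show "r * \<bar>s - s'\<bar> \<le> C / 3" using s by (simp add: field_simps)
  qed
  define x0 where "x0 = x + s * (y - a)"
  \<comment> \<open>The lifts of the common point along the two lines may differ by \<open>n\<close>
    full turns.\<close>
  obtain n where n: "x0 = x' + s' * (y - a') + C * of_int n"
    using eq C by (auto simp: cyl_eq_iff x0_def)
  define Y where "Y w = y + r * (Re w + Im w)" for w
  define X where "X w = x0 + r * (s * Re w + s' * Im w)" for w
  define \<Psi> where "\<Psi> w = cyl C (X w) (Y w)" for w
  have small: "\<bar>r * (s - s') * t\<bar> < C" if "\<bar>t\<bar> < 2" for t
  proof -
    have "\<bar>r * (s - s') * t\<bar> = (r * \<bar>s - s'\<bar>) * \<bar>t\<bar>" using r by (simp add: abs_mult)
    also have "\<dots> \<le> (C / 3) * \<bar>t\<bar>" using r by (intro mult_right_mono) auto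
    also have "\<dots> < C" using that C by (simp add: field_simps)
    finally show ?thesis .
  qed
  have ReIm: "\<bar>Re w\<bar> < 1" "\<bar>Im w\<bar> < 1" if "w \<in> ball 0 1" for w
    using that abs_Re_le_cmod[of w] abs_Im_le_cmod[of w] by auto
  have Yb: "a \<le> Y w" "Y w \<le> b" "a' \<le> Y w" "Y w \<le> b'" if "w \<in> ball 0 1" for w
  proof -
    have "\<bar>r * (Re w + Im w)\<bar> = r * \<bar>Re w + Im w\<bar>" using r by (simp add: abs_mult)
    also have "\<dots> \<le> r * 2" using ReIm[OF that] r by (intro mult_left_mono) auto
    also have "\<dots> \<le> \<delta>" using r \<delta> by simp
    finally have "\<bar>r * (Re w + Im w)\<bar> \<le> \<delta>" .
    then show "a \<le> Y w" "Y w \<le> b" "a' \<le> Y w" "Y w \<le> b'"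
      using \<delta> unfolding Y_def by linarith+
  qed
  \<comment> \<open>The horizontal deviation from the first line depends on \<open>Im w\<close>
    only, and that from the second on \<open>Re w\<close> only. So the lines become the two
    axes.\<close>
  have Xs: "X w = x + s * (Y w - a) - r * (s - s') * Im w" for w
    by (simp add: X_def Y_def x0_def algebra_simps)
  have Xs': "X w = x' + s' * (Y w - a') + r * (s - s') * Re w + C * n" for w
    using n by (simp add: X_def Y_def algebra_simps)
  have zero: "t = 0" if "r * (s - s') * t = C * of_int k" "\<bar>t\<bar> < 2" for t and k :: int
    using abs_int_multiple_less[OF that(1) small[OF that(2)]] r s by simp
  show ?thesis
  proof (rule crosses_at_chart[where \<Psi> = \<Psi>])
    show "continuous_on (ball 0 1) \<Psi>"
      unfolding \<Psi>_def[abs_def] X_def[abs_def] Y_def[abs_def] by (intro continuous_intros)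
    show "inj_on \<Psi> (ball 0 1)"
    proof (rule inj_onI)
      fix v w assume vw: "v \<in> ball 0 1" "w \<in> ball 0 1" "\<Psi> v = \<Psi> w"
      then obtain k :: int where "Y v = Y w" "X v = X w + C * k"
        using C by (auto simp: \<Psi>_def cyl_eq_iff)
      then have "r * (Re v + Im v) = r * (Re w + Im w)" and "r * (s - s') * (Im w - Im v) = C * k"
        using Xs[of v] Xs[of w] by (auto simp: Y_def algebra_simps)
      then have 1: "Re v + Im v = Re w + Im w" and "r * (s - s') * (Im w - Im v) = C * k"
        using r(1) by (simp_all only: mult_cancel_left) auto
      moreover have "\<bar>Im w - Im v\<bar> < 2" using ReIm[OF vw(1)] ReIm[OF vw(2)] by linarith
      ultimately have "Im w - Im v = 0" using zero by blast
      then show "v = w" using 1 by (simp add: complex_eq_iff)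
    qed
    show "\<Psi> 0 = cyl C (x + s * (y - a)) y"
      by (simp add: \<Psi>_def X_def Y_def x0_def)
    show "cyl C (x + s * (y - a)) y \<in> relative_interior_arc (helix C s x a b)"
      using C y by (auto simp: relative_interior_arc_helix)
    show "cyl C (x + s * (y - a)) y \<in> relative_interior_arc (helix C s' x' a' b')"
      using C y unfolding eq by (auto simp: relative_interior_arc_helix)
    fix w :: complex assume w: "w \<in> ball 0 1"
    have "a < b" "a' < b'" using y by auto
    have "\<Psi> w \<in> path_image (helix C s x a b) \<longleftrightarrow> (\<exists>k::int. X w = x + s * (Y w - a) + C * k)"
      using C Yb[OF w] \<open>a < b\<close> by (simp add: \<Psi>_def cyl_in_path_image_helix)
    also have "\<dots> \<longleftrightarrow> (\<exists>k::int. r * (s - s') * Im w = C * k)"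
    proof -
      have "X w = x + s * (Y w - a) + C * k \<longleftrightarrow> r * (s - s') * Im w = C * of_int (- k)" for k :: int
        using Xs[of w] by auto
      then show ?thesis by (metis minus_minus)
    qed
    also have "\<dots> \<longleftrightarrow> Im w = 0"
    proof
      assume "\<exists>k::int. r * (s - s') * Im w = C * k"
      moreover have "\<bar>Im w\<bar> < 2" using ReIm[OF w] by linarith
      ultimately show "Im w = 0" using zero by blast
    qed (auto intro: exI[of _ 0])
    finally show "\<Psi> w \<in> path_image (helix C s x a b) \<longleftrightarrow> Im w = 0" .
    have "\<Psi> w \<in> path_image (helix C s' x' a' b') \<longleftrightarrow> (\<exists>k::int. X w = x' + s' * (Y w - a') + C * k)"
      using C Yb[OF w] \<open>a' < b'\<close> by (simp add: \<Psi>_def cyl_in_path_image_helix)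
    also have "\<dots> \<longleftrightarrow> (\<exists>k::int. r * (s - s') * Re w = C * k)"
    proof -
      \<comment> \<open>The index shift by \<open>n\<close> absorbs the turns between the two chosen
        lifts.\<close>
      have "X w = x' + s' * (Y w - a') + C * of_int (k + n) \<longleftrightarrow> r * (s - s') * Re w = C * k" for k :: int
        using Xs'[of w] by (auto simp: algebra_simps)
      then show ?thesis by (metis diff_add_cancel)
    qed
    also have "\<dots> \<longleftrightarrow> Re w = 0"
    proof
      assume "\<exists>k::int. r * (s - s') * Re w = C * k"
      moreover have "\<bar>Re w\<bar> < 2" using ReIm[OF w] by linarith
      ultimately show "Re w = 0" using zero by blast
    qed (auto intro: exI[of _ 0])
    finally show "\<Psi> w \<in> path_image (helix C s' x' a' b') \<longleftrightarrow> Re w = 0" .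
  qed
qed

section \<open>Complementary regions of closed curves around the cylinder\<close>

lemma below_curve_connected_to_zero:
  assumes C: "C > 0" and S: "0 \<notin> S" "\<And>y'. y' \<le> y \<Longrightarrow> cyl C x y' \<notin> S"
  shows "connected_component (- S) (cyl C x y) 0"
proof -
  \<comment> \<open>Points of this radial segment other than 0 have the same angle and height at
    most \<open>y\<close>.\<close>
  have "closed_segment 0 (cyl C x y) \<subseteq> - S"
  proof
    fix z assume "z \<in> closed_segment 0 (cyl C x y)"
    then obtain u where u: "0 \<le> u" "u \<le> 1" "z = of_real u * cyl C x y"
      by (auto simp: in_segment scaleR_conv_of_real)
    show "z \<in> - S"
    proof (cases "u = 0")
      case False
      then have "z = cyl C x (y + ln u)" using u by (simp add: scale_cyl)
      then show ?thesis using S(2)[of "y + ln u"] u False by simp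
    qed (use u S in simp)
  qed
  then show ?thesis
    unfolding connected_component_def
    by (metis connected_segment ends_in_segment)
qed

text \<open>Go radially outwards beyond the circle of radius \<open>exp b\<close>, then move freely
  outside it, where the complement of the disc is connected.\<close>

lemma above_curve_connected_to_outside:
  assumes C: "C > 0" and S: "\<And>y'. y \<le> y' \<Longrightarrow> cyl C x y' \<notin> S"
    and b: "\<And>z. exp b < norm z \<Longrightarrow> z \<notin> S" and w: "exp b < norm w"
  shows "connected_component (- S) (cyl C x y) w"
proof -
  \<comment> \<open>This height is above \<open>y\<close>, so the way there is radially outwards,
    and above \<open>b\<close>, so it leaves the disc.\<close>
  define z where "z = cyl C x (max y b + 1)"
  have "closed_segment (cyl C x y) z \<subseteq> - S"
  proof
    fix v assume "v \<in> closed_segment (cyl C x y) z"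
    moreover have z: "z = of_real (exp (max y b + 1 - y)) * cyl C x y"
      by (simp add: z_def scale_cyl)
    ultimately obtain u where u: "0 \<le> u" "u \<le> 1"
      "v = of_real (1 - u + u * exp (max y b + 1 - y)) * cyl C x y"
      by (auto simp: in_segment scaleR_conv_of_real algebra_simps)
    define r where "r = 1 - u + u * exp (max y b + 1 - y)"
    have "u * 1 \<le> u * exp (max y b + 1 - y)" using u by (intro mult_left_mono) auto
    then have "r \<ge> 1" by (simp add: r_def)
    then have "v = cyl C x (y + ln r)" using u(3) scale_cyl[of r C x y] by (simp add: r_def)
    then show "v \<in> - S" using S[of "y + ln r"] \<open>r \<ge> 1\<close> by simp
  qed
  then have "connected_component (- S) (cyl C x y) z"
    unfolding connected_component_def by (metis connected_segment ends_in_segment)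
  moreover have "connected_component (- S) z w"
  proof -
    have "connected (- cball (0::complex) (exp b))"
      by (rule connected_complement_bounded_convex) auto
    moreover have "- cball 0 (exp b) \<subseteq> - S" using b by (force simp: not_le)
    moreover have "exp b < exp (max y b + 1)" by simp
    then have "z \<in> - cball 0 (exp b)" by (simp add: z_def norm_cyl)
    moreover have "w \<in> - cball 0 (exp b)" using w by simp
    ultimately show ?thesis unfolding connected_component_def by blast
  qed
  ultimately show ?thesis by (rule connected_component_trans)
qed

text \<open>In the cover the two curves form a V, the graph of a function of the angular coordinate.
  So each ray from the origin meets their union once, below which one can walk to the origin
  and above which one can walk to infinity.\<close>

lemma components_of_V:
  assumes C: "C > 0" and ab: "a < b" and s: "s < 0" "s' > 0" "s' * (b - a) = s * (b - a) + C"
    and S: "S = path_image (helix C s x a b) \<union> path_image (helix C s' x a b)"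
    and low: "cyl C xl a \<noteq> cyl C x a" and high: "cyl C xh b \<noteq> cyl C (x + s * (b - a)) b"
    and K: "K \<in> components (- S)"
  shows "cyl C xl a \<in> K \<or> cyl C xh b \<in> K"
proof -
  \<comment> \<open>The left tip of the V. The right tip is \<open>x1 + C\<close>, the same point of
    the cylinder, so the window from \<open>x1\<close> to \<open>x1 + C\<close> meets each angle
    once.\<close>
  define x1 where "x1 = x + s * (b - a)"
  \<comment> \<open>The height of the V over the angle \<open>t\<close>: the left leg has slope
    \<open>s\<close>, the right leg \<open>s'\<close>.\<close>
  define g where "g t = (if t \<le> x then a + (t - x) / s else a + (t - x) / s')" for t
  have x1: "x1 < x" "x < x1 + C"
    using s ab by (auto simp: x1_def mult_neg_pos) (metis add.commute add_less_cancel_left diff_gt_0_iff_gt mult_pos_pos)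
  have hs: "s * (b - a) \<le> s * (y - a)" "s * (y - a) \<le> 0" "0 \<le> s' * (y - a)" "s' * (y - a) \<le> s' * (b - a)"
    if "a \<le> y" "y \<le> b" for y
    using that s(1,2) by (auto intro: mult_left_mono mult_left_mono_neg mult_nonpos_nonneg)
  have g_bounds: "a \<le> g t" "g t \<le> b" if t: "x1 \<le> t" "t < x1 + C" for t
  proof -
    have "x + s * (b - a) \<le> t" "t \<le> x + s' * (b - a)" using t s(3) by (auto simp: x1_def)
    then show "a \<le> g t" "g t \<le> b"
      using s(1,2) by (auto simp: g_def field_simps)
  qed
  have S_iff: "cyl C t y \<in> S \<longleftrightarrow> y = g t" if t: "x1 \<le> t" "t < x1 + C" for t y
  proof
    assume "cyl C t y \<in> S"
    then consider (1) n :: int where "a \<le> y" "y \<le> b" "t = x + s * (y - a) + C * n"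
      | (2) n :: int where "a \<le> y" "y \<le> b" "t = x + s' * (y - a) + C * n"
      using C ab unfolding S by (auto simp: cyl_in_path_image_helix)
    then show "y = g t"
    proof cases
      case 1
      have "t - x - s * (y - a) = 0"
      proof (rule abs_int_multiple_less)
        show "t - x - s * (y - a) = C * n" using 1 by simp
        show "\<bar>t - x - s * (y - a)\<bar> < C" using hs[OF 1(1,2)] t x1 by (auto simp: x1_def)
      qed
      then have t': "t - x = s * (y - a)" by simp
      then have "t \<le> x" using hs(2)[OF 1(1,2)] by linarith
      then show ?thesis using t' s(1) by (simp add: g_def)
    next
      case 2
      show ?thesis
      proof (cases "\<bar>t - x - s' * (y - a)\<bar> < C")
        case True
        have "t - x - s' * (y - a) = 0"
          by (rule abs_int_multiple_less[OF _ True, of n]) (use 2 in simp)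
        then have t': "t - x = s' * (y - a)" by simp
        then have "t \<ge> x" using hs(3)[OF 2(1,2)] by linarith
        moreover have "y = a" if "t = x" using that t' s(2) by simp
        ultimately show ?thesis using t' s(2) by (auto simp: g_def)
      next
        case False
        \<comment> \<open>A full turn is possible only where the left end of the window meets the
          top of the right leg, which is also the top of the left leg.\<close>
        then have "t = x1" "s' * (y - a) = s' * (b - a)"
          using hs[OF 2(1,2)] t x1 s(3) by (auto simp: x1_def)
        then show ?thesis using s(1,2) x1 by (auto simp: g_def x1_def)
      qed
    qed
  next
    assume "y = g t"
    then have "a \<le> y" "y \<le> b" and "t = x + s * (y - a) \<or> t = x + s' * (y - a)"
      using g_bounds[OF t] s(1,2) by (auto simp: g_def)
    then show "cyl C t y \<in> S"
      unfolding S path_image_helix[OF ab] by auto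
  qed
  have zero: "0 \<notin> S"
    using cyl_nonzero unfolding S path_image_helix[OF ab] by (metis (no_types, lifting) Un_iff imageE)
  have big: "z \<notin> S" if "exp b < norm z" for z
    using that unfolding S path_image_helix[OF ab] by (auto simp: norm_cyl)
  \<comment> \<open>A base point outside all of \<open>S\<close>, standing for infinity.\<close>
  define w where "w = cyl C 0 (b + 1)"
  have w: "exp b < norm w" by (simp add: w_def norm_cyl)
  have below: "connected_component (- S) (cyl C t y) 0" if "x1 \<le> t" "t < x1 + C" "y < g t" for t y
    by (rule below_curve_connected_to_zero[OF C zero]) (use S_iff that in auto)
  have above: "connected_component (- S) (cyl C t y) w" if "x1 \<le> t" "t < x1 + C" "g t < y" for t y
    by (rule above_curve_connected_to_outside[OF C _ big w]) (use S_iff that in auto)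
  \<comment> \<open>The V attains height \<open>a\<close> only at its apex, so any other point of
    that height lies below it.\<close>
  have low0: "connected_component (- S) (cyl C xl a) 0"
  proof -
    obtain t y where t: "x1 \<le> t" "t < x1 + C" "cyl C xl a = cyl C t y"
      using nonzero_eq_cyl[OF C cyl_nonzero] by metis
    then have "y = a" "t \<noteq> x" using C low by (auto simp: cyl_eq_iff)
    then have "y < g t"
      using s(1,2) by (auto simp: g_def divide_neg_neg)
    then show ?thesis using below t by metis
  qed
  \<comment> \<open>The V attains height \<open>b\<close> only at its tip, so any other point of
    that height lies above it.\<close>
  have highw: "connected_component (- S) (cyl C xh b) w"
  proof -
    obtain t y where t: "x1 \<le> t" "t < x1 + C" "cyl C xh b = cyl C t y"
      using nonzero_eq_cyl[OF C cyl_nonzero] by metis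
    then have "y = b" "t \<noteq> x1" using C high by (auto simp: cyl_eq_iff x1_def)
    then have "x + s * (b - a) < t" "t < x + s' * (b - a)" using t s(3) by (auto simp: x1_def)
    then have "g t < y"
      using s(1,2) \<open>y = b\<close> by (auto simp: g_def field_simps)
    then show ?thesis using above t by metis
  qed
  obtain z where z: "z \<in> - S" "K = connected_component_set (- S) z"
    using K by (auto simp: components_def)
  have "connected_component (- S) z 0 \<or> connected_component (- S) z w"
  proof (cases "z = 0")
    case False
    then obtain t y where t: "x1 \<le> t" "t < x1 + C" "z = cyl C t y"
      using nonzero_eq_cyl[OF C] by metis
    then have "y \<noteq> g t" using S_iff z by auto
    then show ?thesis using above below t by (metis linorder_neqE_linordered_idom)
  qed (use zero in auto)
  then show ?thesis
    using low0 highw z(2) by (metis connected_component_sym connected_component_trans mem_Collect_eq)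
qed

section \<open>The periodic pattern\<close>

text \<open>The vertex in column \<open>c\<close> of layer \<open>l\<close> has coordinates \<open>(4 c + x_offset l, height l)\<close>. In each period, edge template
  \<open>j < 14\<close> joins column \<open>c\<close> of layer \<open>lower j\<close> to column \<open>c + col_shift j\<close> of layer \<open>upper j\<close>, where layer 4 is layer 0 of the
  next period. The coordinates come from a computer search. Slopes are scaled by 20 to make them integral,
  so that the properties of the templates reduce to ground integer arithmetic.\<close>

definition lower :: "nat \<Rightarrow> nat" where
  "lower j = [0, 0, 0, 0, 0, 2, 2, 1, 1, 1, 1, 2, 2, 2] ! j"

definition upper :: "nat \<Rightarrow> nat" where
  "upper j = [1, 1, 1, 2, 2, 3, 3, 3, 3, 4, 4, 4, 4, 4] ! j"

definition col_shift :: "nat \<Rightarrow> int" where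
  "col_shift j = [-1, 0, 1, 0, 1, -1, 0, -1, 0, 0, 1, -1, 0, 1] ! j"

definition slope20 :: "nat \<Rightarrow> int" where
  "slope20 j = [-40, 40, 120, 10, 50, -40, 40, -30, 10, -8, 8, -25, -5, 15] ! j"

definition x_offset :: "nat \<Rightarrow> int" where
  "x_offset l = [0, 2, 1, 3] ! (l mod 4)"

definition height :: "nat \<Rightarrow> int" where
  "height l = int (6 * (l div 4) + l mod 4)"

text \<open>Twenty times the horizontal coordinate at height \<open>y\<close> of the copy in column
  0; one column then has width 80.\<close>

definition line20 :: "nat \<Rightarrow> int \<Rightarrow> int" where
  "line20 j y = 20 * x_offset (lower j) + slope20 j * (y - height (lower j))"

text \<open>The pair \<open>(j', d)\<close> is listed when template \<open>j\<close> in column \<open>c\<close> is crossed by template \<open>j'\<close> in column \<open>c + d\<close>.\<close>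

definition crossed_by :: "nat \<Rightarrow> (nat \<times> int) list" where
  "crossed_by j = [[(2,-1),(4,-1)], [], [(0,1),(3,1)], [(2,-1),(7,0)], [(0,1),(7,1)], [], [(9,0),(10,0)],
     [(3,0),(4,-1)], [], [(6,0),(13,0)], [(6,0),(11,1)], [(10,-1),(13,-1)], [], [(9,0),(11,1)]] ! j"

text \<open>The range from -80 to 120 is \<bar>x - 1\<bar> \<le> 5 before scaling. It limits the
  column offsets that the other checks must cover. The layers with residue 1 or 2 are the white
  ones.\<close>

lemma template_check:
  "\<forall>j\<in>set [0..<14]. lower j < upper j \<and> upper j \<le> 4 \<and> height (lower j) < height (upper j)
     \<and> line20 j (height (upper j)) = 20 * (x_offset (upper j) + 4 * col_shift j)
     \<and> (\<forall>t\<in>set [lower j..<Suc (upper j)]. -80 \<le> line20 j (height t) \<and> line20 j (height t) \<le> 120)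
     \<and> (lower j mod 4 \<in> {1, 2}) \<noteq> (upper j mod 4 \<in> {1, 2})
     \<and> length (crossed_by j) \<le> 2"
  by code_simp

text \<open>Over the common height range the difference of two lines is affine, so its values
  \<open>u\<close> and \<open>v\<close> at the ends decide whether it vanishes inside. Two
  coordinates within 5 of 1 differ by at most 10, hence by at most two columns.\<close>

lemma crossing_check:
  "\<forall>j\<in>set [0..<14]. \<forall>j'\<in>set [0..<14]. \<forall>d\<in>set [-2..2].
     (let a = max (height (lower j)) (height (lower j')); b = min (height (upper j)) (height (upper j'));
       u = line20 j a - line20 j' a - 80 * d; v = line20 j b - line20 j' b - 80 * d
      in a < b \<longrightarrow> u * v < 0 \<or> u = 0 \<and> v = 0 \<longrightarrow> j = j' \<and> d = 0 \<or> (j', d) \<in> set (crossed_by j))"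
  by code_simp

lemma vertex_check:
  "\<forall>j\<in>set [0..<14]. \<forall>t\<in>set [lower j..<Suc (upper j)]. \<forall>d\<in>set [-2..2].
     line20 j (height t) = 20 * x_offset t + 80 * d \<longrightarrow> t = lower j \<and> d = 0 \<or> t = upper j \<and> d = col_shift j"
  by code_simp

text \<open>Crossing edges that start or end on a common layer do so exactly one column apart, hence
  at distinct vertices already for two columns. The last conjunct excludes two crossings of one pair
  through different lifts.\<close>

lemma crossed_by_check:
  "\<forall>j\<in>set [0..<14]. \<forall>(j', d)\<in>set (crossed_by j). j' < 14 \<and> slope20 j \<noteq> slope20 j' \<and>
     lower j \<noteq> upper j' \<and> upper j \<noteq> lower j' \<and> (lower j = lower j' \<longrightarrow> \<bar>d\<bar> = 1) \<and>
     (upper j = upper j' \<longrightarrow> \<bar>d + col_shift j' - col_shift j\<bar> = 1) \<and>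
     (\<forall>(j'', d')\<in>set (crossed_by j). j'' = j' \<longrightarrow> d' = d)"
  by code_simp

text \<open>Templates between the same layers can become parallel only by a difference of shifts
  divisible by the number of columns. For a difference of 2 the signs of the slopes give the V
  shape.\<close>

lemma parallel_check:
  "\<forall>j\<in>set [0..<14]. \<forall>j'\<in>set [0..<14]. lower j = lower j' \<and> upper j = upper j' \<longrightarrow>
     \<bar>col_shift j - col_shift j'\<bar> \<le> 2 \<and> (col_shift j = col_shift j' \<longrightarrow> j = j') \<and>
     (col_shift j' = col_shift j + 2 \<longrightarrow> slope20 j < 0 \<and> 0 < slope20 j')"
  by code_simp

section \<open>From ground arithmetic to real lines\<close>

lemma height_period: "height (4 * i + l) = 6 * int i + height l"
  by (simp add: height_def algebra_simps)

lemma x_offset_period: "x_offset (4 * i + l) = x_offset l"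
  by (simp add: x_offset_def)

lemma strict_mono_height: "strict_mono height"
proof (rule strict_mono_Suc_iff[THEN iffD2], rule allI)
  fix l
  show "height l < height (Suc l)"
    unfolding height_def by (cases "Suc (l mod 4) = 4") (auto simp: div_Suc mod_Suc)
qed

lemmas height_le_iff = strict_mono_less_eq[OF strict_mono_height]
lemmas height_eq_iff = strict_mono_eq[OF strict_mono_height]

definition slope :: "nat \<Rightarrow> real" where
  "slope j = slope20 j / 20"

definition line :: "nat \<Rightarrow> real \<Rightarrow> real" where
  "line j y = x_offset (lower j) + slope j * (y - real_of_int (height (lower j)))"

lemma line_of_int: "line j (of_int y) = line20 j y / 20"
  by (simp add: line_def line20_def slope_def field_simps)

text \<open>The values at the ends are \<open>q * (a - y)\<close> and \<open>q * (b - y)\<close>, of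
  opposite sign unless \<open>q = 0\<close>. This replaces a crossing at an unknown real height by a
  test at integer heights.\<close>

lemma affine_sign_change:
  fixes f :: "real \<Rightarrow> real"
  assumes f: "\<And>t. f t = p + q * t" and "a < y" "y < b" "f y = 0"
  shows "f a * f b < 0 \<or> f a = 0 \<and> f b = 0"
proof (cases "q = 0")
  case True
  then show ?thesis using assms by simp
next
  case False
  have "f a = q * (a - y)" "f b = q * (b - y)"
    using f[of a] f[of b] f[of y] assms(4) by (simp_all add: algebra_simps)
  then have "f a * f b = - (q\<^sup>2 * ((y - a) * (b - y)))"
    by (simp only:) (simp add: algebra_simps power2_eq_square)
  moreover have "q\<^sup>2 * ((y - a) * (b - y)) > 0"
    using False assms by (intro mult_pos_pos) auto
  ultimately show ?thesis by linarith
qed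

lemma template_facts:
  assumes j: "j < 14"
  shows lower_less_upper: "lower j < upper j" and upper_le_4: "upper j \<le> 4"
    and line_upper: "line j (height (upper j)) = x_offset (upper j) + 4 * col_shift j"
    and length_crossed_by: "length (crossed_by j) \<le> 2"
    and colours_differ: "(lower j mod 4 \<in> {1, 2}) \<noteq> (upper j mod 4 \<in> {1, 2})"
proof -
  have "j \<in> set [0..<14]" using j by simp
  note * = bspec[OF template_check this]
  show "lower j < upper j" "upper j \<le> 4" "length (crossed_by j) \<le> 2"
    "(lower j mod 4 \<in> {1, 2}) \<noteq> (upper j mod 4 \<in> {1, 2})"
    using * by blast+
  have "line20 j (height (upper j)) = 20 * (x_offset (upper j) + 4 * col_shift j)" using * by blast
  then show "line j (height (upper j)) = x_offset (upper j) + 4 * col_shift j"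
    by (simp add: line_of_int)
qed

text \<open>A line is monotone between its ends, where the bound was checked.\<close>

lemma line_bounds:
  fixes y :: real
  assumes j: "j < 14" and y: "height (lower j) \<le> y" "y \<le> height (upper j)"
  shows "\<bar>line j y - 1\<bar> \<le> 5"
proof -
  have "j \<in> set [0..<14]" using j by simp
  note * = bspec[OF template_check this]
  have t: "\<bar>line j (height t) - 1\<bar> \<le> 5" if "lower j \<le> t" "t \<le> upper j" for t
  proof -
    have "-80 \<le> line20 j (height t)" "line20 j (height t) \<le> 120" using * that by auto
    then have "-80 \<le> real_of_int (line20 j (height t))" "real_of_int (line20 j (height t)) \<le> 120"
      by linarith+
    then show ?thesis unfolding line_of_int by linarith
  qed
  have 1: "\<bar>line j (height (lower j)) - 1\<bar> \<le> 5" "\<bar>line j (height (upper j)) - 1\<bar> \<le> 5"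
    using t lower_less_upper[OF j] by auto
  show ?thesis
  proof (cases "slope j \<ge> 0")
    case True
    then have "line j (height (lower j)) \<le> line j y" "line j y \<le> line j (height (upper j))"
      using y by (auto simp: line_def intro!: mult_left_mono)
    then show ?thesis using 1 by linarith
  next
    case False
    then have "line j y \<le> line j (height (lower j))" "line j (height (upper j)) \<le> line j y"
      using y by (auto simp: line_def mult_nonpos_nonneg intro!: mult_left_mono_neg)
    then show ?thesis using 1 by linarith
  qed
qed

lemma line_through_vertex:
  assumes j: "j < 14" and t: "lower j \<le> t" "t \<le> upper j" and eq: "line j (height t) = x_offset t + 4 * real_of_int d"
  shows "t = lower j \<and> d = 0 \<or> t = upper j \<and> d = col_shift j"
proof -
  have "t \<le> 4" using t upper_le_4[OF j] by simp
  then have "t = 0 \<or> t = 1 \<or> t = 2 \<or> t = 3 \<or> t = 4" by linarith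
  then have "0 \<le> x_offset t \<and> x_offset t \<le> 3" by (elim disjE) (simp_all add: x_offset_def)
  moreover have "\<bar>line j (height t) - 1\<bar> \<le> 5"
    using t by (intro line_bounds j) (auto simp: height_le_iff)
  ultimately have "-2 \<le> d \<and> d \<le> 2" using eq by linarith
  moreover have "line20 j (height t) = 20 * x_offset t + 80 * d"
  proof -
    have "real_of_int (line20 j (height t)) = of_int (20 * x_offset t + 80 * d)"
      using eq unfolding line_of_int by simp
    then show ?thesis by linarith
  qed
  moreover have "j \<in> set [0..<14]" "t \<in> set [lower j..<Suc (upper j)]" using j t by auto
  moreover have "d \<in> set [-2..2]" using calculation(1) by auto
  ultimately show ?thesis using vertex_check by blast
qed

lemma crossed_by_complete:
  fixes y :: real
  assumes j: "j < 14" and y: "height (lower j) < y" "y < height (upper j)"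
    and j': "j' < 14" and y': "height (lower j') < y" "y < height (upper j')"
    and eq: "line j y = line j' y + 4 * real_of_int d"
  shows "j = j' \<and> d = 0 \<or> (j', d) \<in> set (crossed_by j)"
proof -
  define a where "a = max (height (lower j)) (height (lower j'))"
  define b where "b = min (height (upper j)) (height (upper j'))"
  define u where "u z = line20 j z - line20 j' z - 80 * d" for z
  define f where "f z = line j z - line j' z - 4 * d" for z
  have "\<bar>line j y - 1\<bar> \<le> 5" "\<bar>line j' y - 1\<bar> \<le> 5" using y y' by (auto intro!: line_bounds j j')
  \<comment> \<open>Only these offsets are covered by \<open>crossing_check\<close>.\<close>
  then have d: "-2 \<le> d \<and> d \<le> 2" using eq by linarith
  have fu: "f (of_int z) = real_of_int (u z) / 20" for z
    by (simp add: f_def u_def line_of_int diff_divide_distrib)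
  have aff: "f z = (x_offset (lower j) - slope j * height (lower j) - (x_offset (lower j') - slope j' * height (lower j')) - 4 * d)
      + (slope j - slope j') * z" for z
    by (simp add: f_def line_def algebra_simps)
  have ab: "a < y" "y < b" using y y' by (auto simp: a_def b_def)
  moreover have "f y = 0" using eq by (simp add: f_def)
  ultimately have "f a * f b < 0 \<or> f a = 0 \<and> f b = 0"
    by (rule affine_sign_change[OF aff])
  then have "real_of_int (u a * u b) < 0 \<or> u a = 0 \<and> u b = 0"
    by (simp add: fu)
  then have "u a * u b < 0 \<or> u a = 0 \<and> u b = 0" by (simp only: of_int_less_0_iff)
  moreover have "a < b" using ab by linarith
  moreover have "j \<in> set [0..<14]" "j' \<in> set [0..<14]" "d \<in> set [-2..2]" using j j' d by auto
  ultimately show ?thesis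
    using crossing_check unfolding Let_def a_def b_def u_def by blast
qed

lemma crossed_by_sound:
  assumes j: "j < 14" and "(j', d) \<in> set (crossed_by j)"
  shows "j' < 14 \<and> slope j \<noteq> slope j' \<and> lower j \<noteq> upper j' \<and> upper j \<noteq> lower j' \<and> (lower j = lower j' \<longrightarrow> \<bar>d\<bar> = 1)
    \<and> (upper j = upper j' \<longrightarrow> \<bar>d + col_shift j' - col_shift j\<bar> = 1)"
  using crossed_by_check j assms by (fastforce simp: slope_def)

lemma crossed_by_unique:
  assumes j: "j < 14" and "(j', d) \<in> set (crossed_by j)" "(j', d') \<in> set (crossed_by j)"
  shows "d = d'"
  using crossed_by_check j assms by fastforce

text \<open>Vertex \<open>m l + c\<close> is the one in column \<open>c\<close> of layer \<open>l\<close>, and edge \<open>14 (m i + c) + j\<close> is the copy of template \<open>j\<close> in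
  column \<open>c\<close> of period \<open>i\<close>; columns are counted modulo \<open>m\<close>.\<close>

definition vertex_at :: "nat \<Rightarrow> nat \<Rightarrow> int \<Rightarrow> nat" where
  "vertex_at m l c = m * l + nat (c mod int m)"

definition vertex_pos :: "nat \<Rightarrow> nat \<Rightarrow> complex" where
  "vertex_pos m v = cyl (4 * real m) (4 * real (v mod m) + real_of_int (x_offset (v div m))) (height (v div m))"

definition template :: "nat \<Rightarrow> nat" where
  "template e = e mod 14"

definition column :: "nat \<Rightarrow> nat \<Rightarrow> nat" where
  "column m e = e div 14 mod m"

definition period :: "nat \<Rightarrow> nat \<Rightarrow> nat" where
  "period m e = e div 14 div m"

definition incident :: "nat \<Rightarrow> nat \<Rightarrow> nat set" where
  "incident m e = {vertex_at m (4 * period m e + lower (template e)) (column m e),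
     vertex_at m (4 * period m e + upper (template e)) (column m e + col_shift (template e))}"

definition curve :: "nat \<Rightarrow> nat \<Rightarrow> real \<Rightarrow> complex" where
  "curve m e = helix (4 * real m) (slope (template e)) (4 * real (column m e) + real_of_int (x_offset (lower (template e))))
     (height (4 * period m e + lower (template e))) (height (4 * period m e + upper (template e)))"

text \<open>The height \<open>y\<close> is measured from the bottom of the common period. The offset
  \<open>d\<close> is kept as an integer, not modulo \<open>m\<close>, because it selects the lift
  of \<open>f\<close> that meets the lift of \<open>e\<close>.\<close>

definition meet_at :: "nat \<Rightarrow> nat \<Rightarrow> nat \<Rightarrow> int \<Rightarrow> real \<Rightarrow> bool" where
  "meet_at m e f d y \<longleftrightarrow> (template f, d) \<in> set (crossed_by (template e)) \<and> period m f = period m e \<and>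
     int (column m f) mod int m = (int (column m e) + d) mod int m \<and>
     real_of_int (height (lower (template e))) < y \<and> y < real_of_int (height (upper (template e))) \<and>
     real_of_int (height (lower (template f))) < y \<and> y < real_of_int (height (upper (template f))) \<and>
     line (template e) y = line (template f) y + 4 * real_of_int d"

lemma template_less_14: "template e < 14"
  by (simp add: template_def)

lemma height_ends_less: "height (4 * i + lower (template e)) < height (4 * i + upper (template e))"
  using lower_less_upper[OF template_less_14] by (simp add: strict_mono_less[OF strict_mono_height])

lemma finish_coordinate:
  "4 * real (column m e) + real_of_int (x_offset (lower (template e))) + slope (template e) *
      (real_of_int (height (4 * period m e + upper (template e))) - real_of_int (height (4 * period m e + lower (template e))))
    = 4 * real_of_int (column m e + col_shift (template e)) + real_of_int (x_offset (upper (template e)))"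
  using line_upper[OF template_less_14, of e] by (simp add: line_def height_period)

lemma curve_point:
  "4 * real (column m e) + real_of_int (x_offset (lower (template e))) + slope (template e) *
     (6 * real (period m e) + y - real_of_int (height (4 * period m e + lower (template e)))) = 4 * real (column m e) + line (template e) y"
  by (simp add: line_def height_period)

lemma height_template_bounds: "j < 14 \<Longrightarrow> 0 \<le> height (lower j) \<and> height (upper j) \<le> 6"
proof -
  assume "j < 14"
  then have "height (upper j) \<le> height 4" unfolding height_le_iff by (rule upper_le_4)
  then show ?thesis by (simp add: height_def)
qed

lemma edge_eqI:
  assumes "template e = template f" "column m e = column m f" "period m e = period m f"
  shows "e = f"
proof -
  have "e div 14 = f div 14"
    using assms(2,3) unfolding column_def period_def by (metis div_mult_mod_eq)
  then show ?thesis
    using assms(1) unfolding template_def by (metis div_mult_mod_eq)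
qed

section \<open>The drawing with \<open>m\<close> columns\<close>

context
  fixes m :: nat
  assumes m: "m > 0"
begin

lemma vertex_at_div: "vertex_at m l c div m = l" and vertex_at_mod: "int (vertex_at m l c mod m) = c mod int m"
proof -
  have *: "nat (c mod int m) < m" using m by (simp add: nat_less_iff)
  show "vertex_at m l c div m = l" using * by (simp add: vertex_at_def)
  show "int (vertex_at m l c mod m) = c mod int m" using * m by (simp add: vertex_at_def)
qed

lemma vertex_at_eq_iff: "vertex_at m l c = vertex_at m l' c' \<longleftrightarrow> l = l' \<and> c mod int m = c' mod int m"
  by (metis vertex_at_def vertex_at_div vertex_at_mod)

lemma vertex_at_self: "vertex_at m (v div m) (int (v mod m)) = v"
  by (simp add: vertex_at_def zmod_int[symmetric])

text \<open>Columns are 4 apart and the circumference is \<open>4 * m\<close>, so full turns are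
  multiples of \<open>m\<close> columns.\<close>

lemma real_mod_eq_iff:
  "(\<exists>n::int. 4 * real_of_int a + r = 4 * real_of_int b + r + 4 * real m * n) \<longleftrightarrow> a mod int m = b mod int m"
proof -
  have "4 * real_of_int a + r = 4 * real_of_int b + r + 4 * real m * n \<longleftrightarrow> a = b + int m * n" for n :: int
  proof -
    have "4 * real_of_int a + r = 4 * real_of_int b + r + 4 * real m * n
        \<longleftrightarrow> real_of_int a = real_of_int (b + int m * n)" by auto
    then show ?thesis by (simp only: of_int_eq_iff)
  qed
  then show ?thesis
    by (metis mod_eqE mod_mult_self2 add_diff_cancel_left' diff_add_cancel add.commute)
qed

lemma cyl_vertex_eq_iff:
  "cyl (4 * real m) (4 * real_of_int c + real_of_int (x_offset l)) (height l) = cyl (4 * real m) (4 * real_of_int c' + real_of_int (x_offset l')) (height l')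
     \<longleftrightarrow> vertex_at m l c = vertex_at m l' c'"
proof -
  have "0 < 4 * real m" using m by simp
  from cyl_eq_iff[OF this] show ?thesis
    using real_mod_eq_iff[of c "real_of_int (x_offset l)" c'] unfolding vertex_at_eq_iff of_int_eq_iff height_eq_iff
    by (auto simp: height_eq_iff)
qed

lemma vertex_pos_at: "vertex_pos m (vertex_at m l c) = cyl (4 * real m) (4 * real_of_int c + real_of_int (x_offset l)) (height l)"
proof -
  have "vertex_pos m (vertex_at m l c) = cyl (4 * real m) (4 * real_of_int (c mod int m) + real_of_int (x_offset l)) (height l)"
    using arg_cong[OF vertex_at_mod, of real_of_int l c] by (simp add: vertex_pos_def vertex_at_div)
  also have "\<dots> = cyl (4 * real m) (4 * real_of_int c + real_of_int (x_offset l)) (height l)"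
    unfolding cyl_vertex_eq_iff by (simp add: vertex_at_eq_iff)
  finally show ?thesis .
qed

lemma inj_vertex_pos: "inj (vertex_pos m)"
proof (rule injI)
  fix u v assume "vertex_pos m u = vertex_pos m v"
  then have "vertex_pos m (vertex_at m (u div m) (int (u mod m))) = vertex_pos m (vertex_at m (v div m) (int (v mod m)))"
    by (simp add: vertex_at_self)
  then have "vertex_at m (u div m) (int (u mod m)) = vertex_at m (v div m) (int (v mod m))"
    unfolding vertex_pos_at cyl_vertex_eq_iff .
  then show "u = v" by (simp add: vertex_at_self)
qed

lemma arc_curve: "arc (curve m e)"
  unfolding curve_def using m height_ends_less by (intro arc_helix) auto

lemma curve_ends: "{pathstart (curve m e), pathfinish (curve m e)} = vertex_pos m ` incident m e"
  unfolding curve_def incident_def pathstart_helix pathfinish_helix finish_coordinate image_insert vertex_pos_at x_offset_period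
  by simp

lemma vertex_on_curve:
  assumes "vertex_pos m v \<in> path_image (curve m e)"
  shows "v \<in> incident m e"
proof -
  let ?i = "period m e" and ?j = "template e" and ?c = "column m e"
  define l where "l = v div m"
  have C: "0 < 4 * real m" using m by simp
  have "cyl (4 * real m) (4 * real (v mod m) + real_of_int (x_offset l)) (height l) \<in> path_image (curve m e)"
    using assms by (simp add: vertex_pos_def l_def)
  then obtain n :: int where
    l: "height (4 * ?i + lower ?j) \<le> height l" "height l \<le> height (4 * ?i + upper ?j)" and
    n: "4 * real (v mod m) + x_offset l = 4 * real ?c + x_offset (lower ?j)
      + slope ?j * (real_of_int (height l) - height (4 * ?i + lower ?j)) + 4 * real m * n"
    unfolding curve_def using height_ends_less C by (auto simp: cyl_in_path_image_helix)
  define t where "t = l - 4 * ?i"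
  have t: "l = 4 * ?i + t" "lower ?j \<le> t" "t \<le> upper ?j"
    using l by (auto simp: height_le_iff t_def)
  \<comment> \<open>Adding the turns \<open>n\<close> gives the column offset in the cover, where
    \<open>line_through_vertex\<close> applies.\<close>
  define d where "d = int (v mod m) - int ?c - int m * n"
  have "line ?j (height t) = x_offset t + 4 * real_of_int d"
    using n unfolding t(1) height_period x_offset_period by (simp add: line_def d_def algebra_simps)
  then have "t = lower ?j \<and> d = 0 \<or> t = upper ?j \<and> d = col_shift ?j"
    using t by (intro line_through_vertex template_less_14)
  moreover have "v = vertex_at m l (int (v mod m))" by (simp add: l_def vertex_at_self)
  moreover have "int (v mod m) = int ?c + d + int m * n" by (simp add: d_def)
  ultimately show ?thesis
    unfolding incident_def t(1) by (auto simp: vertex_at_eq_iff)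
qed

lemma relative_interior_curve:
  assumes "p \<in> relative_interior_arc (curve m e)"
  obtains y :: real where "height (lower (template e)) < y" "y < height (upper (template e))"
    "p = cyl (4 * real m) (4 * real (column m e) + line (template e) y) (6 * real (period m e) + y)"
proof -
  have C: "0 < 4 * real m" using m by simp
  obtain z :: real where z: "height (4 * period m e + lower (template e)) < z" "z < height (4 * period m e + upper (template e))"
    "p = cyl (4 * real m) (4 * real (column m e) + real_of_int (x_offset (lower (template e)))
      + slope (template e) * (z - height (4 * period m e + lower (template e)))) z"
    using assms unfolding curve_def using relative_interior_arc_helix[OF C] height_ends_less by auto
  show ?thesis
  proof
    show "height (lower (template e)) < z - 6 * real (period m e)" "z - 6 * real (period m e) < height (upper (template e))"
      using z(1,2) by (auto simp: height_period)
    show "p = cyl (4 * real m) (4 * real (column m e) + line (template e) (z - 6 * real (period m e))) (6 * real (period m e) + (z - 6 * real (period m e)))"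
      using z(3) by (simp add: line_def height_period diff_diff_eq add.assoc)
  qed
qed

lemma common_point:
  assumes "e \<noteq> f" "p \<in> relative_interior_arc (curve m e)" "p \<in> relative_interior_arc (curve m f)"
  obtains d :: int and y :: real where "meet_at m e f d y"
    "p = cyl (4 * real m) (4 * real (column m e) + line (template e) y) (6 * real (period m e) + y)"
    "p = cyl (4 * real m) (4 * real (column m f) + line (template f) y) (6 * real (period m f) + y)"
proof -
  obtain y :: real where y: "height (lower (template e)) < y" "y < height (upper (template e))"
    "p = cyl (4 * real m) (4 * real (column m e) + line (template e) y) (6 * real (period m e) + y)"
    using relative_interior_curve[OF assms(2)] .
  obtain z :: real where z: "height (lower (template f)) < z" "z < height (upper (template f))"
    "p = cyl (4 * real m) (4 * real (column m f) + line (template f) z) (6 * real (period m f) + z)"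
    using relative_interior_curve[OF assms(3)] .
  have C: "0 < 4 * real m" using m by simp
  obtain n :: int where eq: "6 * real (period m e) + y = 6 * real (period m f) + z"
    "4 * real (column m e) + line (template e) y = 4 * real (column m f) + line (template f) z + 4 * real m * n"
    using y(3)[unfolded z(3) cyl_eq_iff[OF C]] y(3) z(3) cyl_eq_iff[OF C] by metis
  \<comment> \<open>Periods occupy disjoint open height ranges of length 6, so edges of different
    periods have no common interior point.\<close>
  have "0 < y" "y < 6" "0 < z" "z < 6"
    using y z height_template_bounds[OF template_less_14, of e] height_template_bounds[OF template_less_14, of f] by linarith+
  then have "period m f = period m e" using eq(1) by linarith
  then have period: "period m f = period m e" "z = y" using eq(1) by simp_all
  define d where "d = int (column m f) - int (column m e) + int m * n"
  have line: "line (template e) y = line (template f) y + 4 * real_of_int d"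
    using eq(2) period by (simp add: d_def algebra_simps)
  have "template e = template f \<and> d = 0 \<or> (template f, d) \<in> set (crossed_by (template e))"
    using y z period line by (intro crossed_by_complete template_less_14) auto
  moreover have cols: "int (column m f) mod int m = (int (column m e) + d) mod int m"
    by (simp add: d_def)
  \<comment> \<open>Offset 0 with equal templates would force \<open>e = f\<close>, so only the
    listed case remains.\<close>
  moreover have "column m e < m" "column m f < m" using m by (simp_all add: column_def)
  then have "d = 0 \<longrightarrow> column m e = column m f" using cols by auto
  ultimately have "(template f, d) \<in> set (crossed_by (template e))"
    using edge_eqI[of e f] period assms(1) by metis
  then have "meet_at m e f d y"
    using y z period line cols by (simp add: meet_at_def)
  then show ?thesis using that y(3) z(3) period by blast
qed

lemma meet_at_crosses:
  assumes "meet_at m e f d y"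
    "p = cyl (4 * real m) (4 * real (column m e) + line (template e) y) (6 * real (period m e) + y)"
    "p = cyl (4 * real m) (4 * real (column m f) + line (template f) y) (6 * real (period m f) + y)"
  shows "crosses_at (curve m e) (curve m f) p"
proof -
  have C: "0 < 4 * real m" using m by simp
  have s: "slope (template e) \<noteq> slope (template f)"
    using crossed_by_sound[OF template_less_14] assms(1) unfolding meet_at_def by blast
  have period: "period m f = period m e" using assms(1) by (simp add: meet_at_def)
  let ?y = "6 * real (period m e) + y"
  have e: "p = cyl (4 * real m) (4 * real (column m e) + real_of_int (x_offset (lower (template e))) + slope (template e) *
     (?y - real_of_int (height (4 * period m e + lower (template e))))) ?y"
    using assms(2) by (simp only: curve_point)
  have f: "p = cyl (4 * real m) (4 * real (column m f) + real_of_int (x_offset (lower (template f))) + slope (template f) *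
     (?y - real_of_int (height (4 * period m f + lower (template f))))) ?y"
    using assms(3)[folded curve_point] unfolding period .
  show ?thesis
    unfolding curve_def e
    by (rule crosses_at_helix[OF C _ _ _ _ s e[symmetric, THEN trans, OF f]])
      (use assms(1) period in \<open>auto simp: meet_at_def height_period\<close>)
qed

text \<open>Lines of different slopes agree at one height only. Allowing two edges \<open>f\<close>
  and \<open>f'\<close> serves both the single crossing of a pair and the count of crossings on an
  edge.\<close>

lemma meet_at_level_unique:
  assumes "meet_at m e f d y" "meet_at m e f' d y'" "template f = template f'"
  shows "y = y'"
proof -
  have s: "slope (template e) \<noteq> slope (template f)"
    using crossed_by_sound[OF template_less_14] assms(1) unfolding meet_at_def by blast
  have "line (template e) y = line (template f) y + 4 * d" "line (template e) y' = line (template f) y' + 4 * d"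
    using assms by (auto simp: meet_at_def)
  then have "(slope (template e) - slope (template f)) * (y - y') = 0"
    by (simp add: line_def algebra_simps)
  then show ?thesis using s by simp
qed

text \<open>A common vertex would have to be the lower end of both edges or the upper end of both.
  There the columns differ by \<plusminus>1, which is nonzero modulo \<open>m\<close> once
  \<open>m \<ge> 2\<close>.\<close>

lemma meet_at_disjoint:
  assumes "m \<ge> 2" "meet_at m e f d y"
  shows "incident m e \<inter> incident m f = {}"
proof -
  have *: "lower (template e) \<noteq> upper (template f)" "upper (template e) \<noteq> lower (template f)" "lower (template e) = lower (template f) \<longrightarrow> \<bar>d\<bar> = 1"
    "upper (template e) = upper (template f) \<longrightarrow> \<bar>d + col_shift (template f) - col_shift (template e)\<bar> = 1"
    using crossed_by_sound[OF template_less_14] assms(2) unfolding meet_at_def by blast+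
  have period: "period m f = period m e" and cols: "int (column m f) mod int m = (int (column m e) + d) mod int m"
    using assms(2) by (auto simp: meet_at_def)
  have no: "x mod int m \<noteq> (x + t) mod int m" if "\<bar>t\<bar> = 1" for x t
  proof
    assume "x mod int m = (x + t) mod int m"
    then have "int m dvd t" by (metis add_diff_cancel_left' mod_eq_dvd_iff)
    then have "\<bar>int m\<bar> \<le> \<bar>t\<bar>" using that by (intro dvd_imp_le_int) auto
    then show False using that assms(1) by linarith
  qed
  have "(int (column m f) + col_shift (template f)) mod int m = ((int (column m e) + d) + col_shift (template f)) mod int m"
    using cols by (metis mod_add_left_eq)
  also have "\<dots> = ((int (column m e) + col_shift (template e)) + (d + col_shift (template f) - col_shift (template e))) mod int m"
    by (simp add: algebra_simps)
  finally have **: "(int (column m f) + col_shift (template f)) mod int m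
      = ((int (column m e) + col_shift (template e)) + (d + col_shift (template f) - col_shift (template e))) mod int m" .
  show ?thesis
    using * no[of d "int (column m e)"] no[of "d + col_shift (template f) - col_shift (template e)" "int (column m e) + col_shift (template e)"]
    unfolding incident_def by (auto simp: vertex_at_eq_iff period cols **)
qed

end

section \<open>Finite parts of the pattern\<close>

definition pattern :: "nat \<Rightarrow> nat set \<Rightarrow> nat set \<Rightarrow> (nat, nat) multigraph" where
  "pattern m V E = \<lparr>verts = V, edges = E, ends = incident m\<rparr>"

lemma pattern_simps [simp]:
  "verts (pattern m V E) = V" "edges (pattern m V E) = E" "ends (pattern m V E) = incident m"
  by (simp_all add: pattern_def)

section \<open>Properties of the drawing\<close>

lemma crosses_at_interior:
  "crosses_at g h p \<Longrightarrow> p \<in> relative_interior_arc g \<and> p \<in> relative_interior_arc h"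
  by (simp add: crosses_at_def)

lemma topological_drawing_pattern:
  assumes m: "m \<ge> 2"
  shows "topological_drawing (pattern m V E) (vertex_pos m) (curve m)"
proof -
  have m0: "m > 0" using m by simp
  have "crosses_at (curve m e) (curve m f) p"
    if ne: "e \<noteq> f" and p: "p \<in> relative_interior_arc (curve m e) \<inter> relative_interior_arc (curve m f)" for e f p
    by (rule common_point[OF m0 ne, of p]) (use p meet_at_crosses[OF m0] in blast)+
  moreover have "\<not> crosses_at (curve m e) (curve m f) p"
    if ne: "e \<noteq> f" and adj: "incident m e \<inter> incident m f \<noteq> {}" for e f p
  proof
    assume "crosses_at (curve m e) (curve m f) p"
    then have "p \<in> relative_interior_arc (curve m e)" "p \<in> relative_interior_arc (curve m f)"
      using crosses_at_interior by blast+
    then show False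
      by (rule common_point[OF m0 ne]) (use meet_at_disjoint[OF m0 m] adj in blast)
  qed
  moreover have "p = q"
    if ne: "e \<noteq> f" and p: "crosses_at (curve m e) (curve m f) p" and q: "crosses_at (curve m e) (curve m f) q" for e f p q
  proof -
    obtain d y where 1: "meet_at m e f d y"
    "p = cyl (4 * real m) (4 * real (column m e) + line (template e) y) (6 * real (period m e) + y)"
      using common_point[OF m0 ne] crosses_at_interior[OF p] by metis
    obtain d' y' where 2: "meet_at m e f d' y'" "q = cyl (4 * real m) (4 * real (column m e) + line (template e) y') (6 * real (period m e) + y')"
      using common_point[OF m0 ne] crosses_at_interior[OF q] by metis
    \<comment> \<open>Both crossings use the same template of \<open>f\<close>, and the list
      contains at most one offset for it.\<close>
    have "d = d'" using crossed_by_unique[OF template_less_14] 1(1) 2(1) unfolding meet_at_def by blast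
    then have "y = y'" using meet_at_level_unique[OF m0 1(1)] 2(1) by blast
    then show ?thesis using 1 2 by simp
  qed
  ultimately show ?thesis
    unfolding topological_drawing_def
    using inj_on_subset[OF inj_vertex_pos[OF m0]] arc_curve[OF m0] curve_ends[OF m0] vertex_on_curve[OF m0]
    by simp
qed

text \<open>Crossings on \<open>e\<close> inject into the list of its template: an entry fixes
  template, period and column of the other edge, and the height of the crossing. The list has at
  most two entries.\<close>

lemma crossings_pattern:
  assumes m: "m > 0"
  shows "finite (crossings (pattern m V E) (curve m) e) \<and> card (crossings (pattern m V E) (curve m) e) \<le> 2"
proof -
  let ?X = "crossings (pattern m V E) (curve m) e" and ?T = "set (crossed_by (template e))"
  define R where "R = (\<lambda>(f, p) (j, d). \<exists>y. meet_at m e f d y \<and> template f = j \<and>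
    p = cyl (4 * real m) (4 * real (column m e) + line (template e) y) (6 * real (period m e) + y))"
  have ex: "\<exists>b\<in>?T. R a b" if X: "a \<in> ?X" for a
  proof -
    obtain f p where a: "a = (f, p)" "f \<noteq> e" "crosses_at (curve m e) (curve m f) p"
      using X by (auto simp: crossings_def)
    then obtain d y where "meet_at m e f d y"
    "p = cyl (4 * real m) (4 * real (column m e) + line (template e) y) (6 * real (period m e) + y)"
      using common_point[OF m, of e f p] crosses_at_interior by metis
    then show ?thesis
      unfolding a R_def by (intro bexI[of _ "(template f, d)"]) (auto simp: meet_at_def)
  qed
  have un: "a = a'" if R: "R a b" "R a' b" for a a' b
  proof -
    obtain f p f' p' j d where a: "a = (f, p)" "a' = (f', p')" "b = (j, d)"
      by (metis surj_pair)
    obtain y where y: "meet_at m e f d y" "template f = j"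
    "p = cyl (4 * real m) (4 * real (column m e) + line (template e) y) (6 * real (period m e) + y)"
      using R(1) by (auto simp: R_def a)
    obtain y' where y': "meet_at m e f' d y'" "template f' = j" "p' = cyl (4 * real m) (4 * real (column m e) + line (template e) y') (6 * real (period m e) + y')"
      using R(2) by (auto simp: R_def a)
    have "y = y'" using meet_at_level_unique[OF m y(1) y'(1)] y(2) y'(2) by simp
    have "int (column m f) mod int m = int (column m f') mod int m"
      using y(1) y'(1) by (simp add: meet_at_def)
    then have "column m f = column m f'" using m by (simp add: column_def zmod_int[symmetric])
    then have "f = f'" using y y' by (intro edge_eqI[of f f' m]) (auto simp: meet_at_def)
    then show ?thesis using a y(3) y'(3) \<open>y = y'\<close> by simp
  qed
  obtain F where F: "\<And>a. a \<in> ?X \<Longrightarrow> F a \<in> ?T \<and> R a (F a)" using ex by metis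
  have inj: "inj_on F ?X" using F un by (metis inj_onI)
  have sub: "F ` ?X \<subseteq> ?T" using F by blast
  have "card ?X \<le> card ?T" using inj sub by (rule card_inj_on_le) simp
  also have "\<dots> \<le> 2" using card_length length_crossed_by[OF template_less_14] by (rule order_trans)
  finally show ?thesis using inj_on_finite[OF inj sub] by simp
qed

text \<open>The layers of the two ends are ordered, so equal end sets match lower with lower and
  upper with upper. Lower layers are below 4, so the period can be read off.\<close>

lemma incident_eq_iff:
  assumes m: "m > 0"
  shows "incident m e = incident m f \<longleftrightarrow> period m e = period m f \<and> column m e = column m f \<and>
    lower (template e) = lower (template f) \<and> upper (template e) = upper (template f) \<and> col_shift (template e) mod int m = col_shift (template f) mod int m"
  (is "?l \<longleftrightarrow> ?r")
proof
  assume ?r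
  then show ?l
    unfolding incident_def by (simp add: vertex_at_eq_iff[OF m] doubleton_eq_iff) (metis mod_add_right_eq)
next
  assume l: ?l
  let ?a = "lower (template e)" and ?b = "upper (template e)" and ?a' = "lower (template f)" and ?b' = "upper (template f)"
  have t: "?a < ?b" "?b \<le> 4" "?a' < ?b'" "?b' \<le> 4"
    using lower_less_upper[OF template_less_14] upper_le_4[OF template_less_14] by auto
  have *: "4 * period m e + ?a = 4 * period m f + ?a'" "4 * period m e + ?b = 4 * period m f + ?b'"
    "int (column m e) mod int m = int (column m f) mod int m"
    "(int (column m e) + col_shift (template e)) mod int m = (int (column m f) + col_shift (template f)) mod int m"
    using l t unfolding incident_def doubleton_eq_iff vertex_at_eq_iff[OF m] by auto
  have period: "period m e = period m f" using *(1,2) t by linarith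
  have column: "column m e = column m f" using *(3) by (simp add: column_def zmod_int[symmetric])
  have "col_shift (template e) mod int m = col_shift (template f) mod int m"
    using *(4) unfolding column by (metis add.commute add_diff_cancel_right' mod_diff_left_eq)
  then show ?r using * period column by simp
qed

lemma parallel_templates:
  assumes "j < 14" "j' < 14" "lower j = lower j'" "upper j = upper j'"
  shows "\<bar>col_shift j - col_shift j'\<bar> \<le> 2 \<and> (col_shift j = col_shift j' \<longrightarrow> j = j') \<and>
     (col_shift j' = col_shift j + 2 \<longrightarrow> slope j < 0 \<and> 0 < slope j')"
proof -
  have "j \<in> set [0..<14]" "j' \<in> set [0..<14]" using assms by auto
  then have "\<bar>col_shift j - col_shift j'\<bar> \<le> 2 \<and> (col_shift j = col_shift j' \<longrightarrow> j = j') \<and>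
     (col_shift j' = col_shift j + 2 \<longrightarrow> slope20 j < 0 \<and> 0 < slope20 j')"
    using parallel_check assms by blast
  then show ?thesis by (simp add: slope_def)
qed

text \<open>Shifts of templates between the same layers differ by at most 2, so congruence modulo
  \<open>m \<ge> 3\<close> makes them equal.\<close>

lemma incident_inj:
  assumes m: "m \<ge> 3"
  shows "inj (incident m)"
proof (rule injI)
  fix e f assume "incident m e = incident m f"
  then have *: "period m e = period m f" "column m e = column m f" "lower (template e) = lower (template f)" "upper (template e) = upper (template f)"
    and s: "col_shift (template e) mod int m = col_shift (template f) mod int m"
    using m by (auto simp: incident_eq_iff)
  have "\<bar>col_shift (template e) - col_shift (template f)\<bar> \<le> 2" and j: "col_shift (template e) = col_shift (template f) \<longrightarrow> template e = template f"
    using parallel_templates[OF template_less_14 template_less_14 *(3,4)] by blast+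
  moreover have "int m dvd col_shift (template e) - col_shift (template f)" using s by (simp add: mod_eq_dvd_iff)
  ultimately have "col_shift (template e) - col_shift (template f) = 0"
    using m dvd_imp_le_int[of "col_shift (template e) - col_shift (template f)" "int m"] by linarith
  then show "e = f" using j * edge_eqI[of e f m] by simp
qed

lemma parallel_edges_2:
  assumes "incident 2 e = incident 2 f" "e \<noteq> f"
  shows "period 2 e = period 2 f" "column 2 e = column 2 f" "lower (template e) = lower (template f)" "upper (template e) = upper (template f)"
    "col_shift (template f) = col_shift (template e) + 2 \<or> col_shift (template e) = col_shift (template f) + 2"
proof -
  show *: "period 2 e = period 2 f" "column 2 e = column 2 f" "lower (template e) = lower (template f)" "upper (template e) = upper (template f)"
    using assms by (auto simp: incident_eq_iff)
  have s: "col_shift (template e) mod 2 = col_shift (template f) mod 2"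
    using assms by (auto simp: incident_eq_iff)
  have "\<bar>col_shift (template e) - col_shift (template f)\<bar> \<le> 2" and "col_shift (template e) = col_shift (template f) \<longrightarrow> template e = template f"
    using parallel_templates[OF template_less_14 template_less_14 *(3,4)] by blast+
  moreover have "template e \<noteq> template f" using edge_eqI[of e f 2] * assms(2) by blast
  ultimately show "col_shift (template f) = col_shift (template e) + 2 \<or> col_shift (template e) = col_shift (template f) + 2"
    using s by presburger
qed

text \<open>Parallel edges form a V around the cylinder. Each layer has two vertices, and those not
  on the V in its bottom and top layers lie in different regions. The hypothesis ensures that all
  layers up to \<open>4 * period 2 e + 4\<close> are present.\<close>

lemma no_homotopic_edges_pattern_2:
  assumes V: "\<And>e. e \<in> E \<Longrightarrow> 8 * period 2 e + 10 \<le> N"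
  shows "no_homotopic_edges (pattern 2 {..<N} E) (vertex_pos 2) (curve 2)"
proof -
  have m: "(2::nat) > 0" by simp
  have main: "\<exists>v<N. vertex_pos 2 v \<in> K"
    if e: "e \<in> E" and inc: "incident 2 e = incident 2 f" "e \<noteq> f" and s: "col_shift (template f) = col_shift (template e) + 2"
      and K: "K \<in> components (- (path_image (curve 2 e) \<union> path_image (curve 2 f)))" for e f K
  proof -
    note * = parallel_edges_2[OF inc]
    let ?i = "period 2 e" and ?c = "column 2 e" and ?a = "lower (template e)" and ?b = "upper (template e)"
    \<comment> \<open>The vertices beside the common lower end and beside the common upper
      end.\<close>
    let ?l = "vertex_at 2 (4 * ?i + ?a) (int ?c + 1)" and ?h = "vertex_at 2 (4 * ?i + ?b) (int ?c + col_shift (template e) + 1)"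
    have sl: "slope (template e) < 0" "slope (template f) > 0"
      using parallel_templates[OF template_less_14 template_less_14 *(3,4)] s by blast+
    have hb: "?b \<le> 4" "?a < ?b" using upper_le_4 lower_less_upper template_less_14 by auto
    \<comment> \<open>Two columns more make one full turn of the circumference 8.\<close>
    have fin: "slope (template f) * (real_of_int (height (4 * ?i + ?b)) - real_of_int (height (4 * ?i + ?a)))
        = slope (template e) * (real_of_int (height (4 * ?i + ?b)) - real_of_int (height (4 * ?i + ?a))) + 4 * real 2"
      using finish_coordinate[of 2 e] finish_coordinate[of 2 f] * s by (simp add: algebra_simps)
    have ne: "(x + 1) mod int 2 \<noteq> x mod int 2" for x :: int by presburger
    have "vertex_pos 2 ?l \<in> K \<or> vertex_pos 2 ?h \<in> K"
      unfolding vertex_pos_at[OF m]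
    proof (rule components_of_V[OF _ _ sl fin _ _ _ K])
      show "(0::real) < 4 * real 2" by simp
      show "real_of_int (height (4 * ?i + ?a)) < height (4 * ?i + ?b)" using height_ends_less by simp
      show "path_image (curve 2 e) \<union> path_image (curve 2 f)
        = path_image (helix (4 * real 2) (slope (template e)) (4 * real_of_int (int ?c) + real_of_int (x_offset (4 * ?i + ?a)))
            (height (4 * ?i + ?a)) (height (4 * ?i + ?b))) \<union>
          path_image (helix (4 * real 2) (slope (template f)) (4 * real_of_int (int ?c) + real_of_int (x_offset (4 * ?i + ?a)))
            (height (4 * ?i + ?a)) (height (4 * ?i + ?b)))"
        using * by (simp add: curve_def x_offset_period)
      show "cyl (4 * real 2) (4 * real_of_int (int ?c + 1) + real_of_int (x_offset (4 * ?i + ?a))) (height (4 * ?i + ?a))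
        \<noteq> cyl (4 * real 2) (4 * real_of_int (int ?c) + real_of_int (x_offset (4 * ?i + ?a))) (height (4 * ?i + ?a))"
        unfolding cyl_vertex_eq_iff[OF m] vertex_at_eq_iff[OF m] using ne by blast
      have fc: "4 * real_of_int (int ?c) + real_of_int (x_offset (4 * ?i + ?a)) + slope (template e) * (real_of_int (height (4 * ?i + ?b)) - real_of_int (height (4 * ?i + ?a)))
        = 4 * real_of_int (int ?c + col_shift (template e)) + real_of_int (x_offset (4 * ?i + ?b))"
        using finish_coordinate[of 2 e] by (simp add: x_offset_period)
      show "cyl (4 * real 2) (4 * real_of_int (int ?c + col_shift (template e) + 1) + real_of_int (x_offset (4 * ?i + ?b))) (height (4 * ?i + ?b))
        \<noteq> cyl (4 * real 2) (4 * real_of_int (int ?c) + real_of_int (x_offset (4 * ?i + ?a))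
            + slope (template e) * (real_of_int (height (4 * ?i + ?b)) - real_of_int (height (4 * ?i + ?a)))) (height (4 * ?i + ?b))"
        unfolding fc cyl_vertex_eq_iff[OF m] vertex_at_eq_iff[OF m] using ne by blast
    qed
    moreover have "vertex_at 2 (4 * ?i + t) c < N" if "t \<le> 4" for t c
    proof -
      have "nat (c mod 2) < 2" by (simp add: nat_less_iff)
      then have "vertex_at 2 (4 * ?i + t) c < 8 * ?i + 10" using that unfolding vertex_at_def by simp
      then show ?thesis using V[OF e] by linarith
    qed
    moreover have "?a \<le> 4" using hb by simp
    ultimately show ?thesis using hb(1) by blast
  qed
  show ?thesis
    unfolding no_homotopic_edges_def
  proof (intro ballI impI)
    fix e f K
    assume "e \<in> edges (pattern 2 {..<N} E)" "f \<in> edges (pattern 2 {..<N} E)"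
      and "e \<noteq> f \<and> ends (pattern 2 {..<N} E) e = ends (pattern 2 {..<N} E) f"
      and K: "K \<in> components (- (path_image (curve 2 e) \<union> path_image (curve 2 f)))"
    then have *: "e \<in> E" "f \<in> E" "e \<noteq> f" "f \<noteq> e" "incident 2 e = incident 2 f" "incident 2 f = incident 2 e" by auto
    \<comment> \<open>Whichever edge has the smaller shift plays the left leg.\<close>
    have "\<exists>v<N. vertex_pos 2 v \<in> K"
      using parallel_edges_2(5)[OF *(5,3)] main[OF *(1,5,3) _ K] main[OF *(2,6,4) _ K[unfolded Un_commute[of "path_image (curve 2 e)"]]]
      by blast
    then show "\<exists>v\<in>verts (pattern 2 {..<N} E). vertex_pos 2 v \<in> K" by auto
  qed
qed

section \<open>Colouring and size of the finite parts\<close>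

lemma incident_card: "m > 0 \<Longrightarrow> card (incident m e) = 2"
  using lower_less_upper[OF template_less_14, of e] by (simp add: incident_def vertex_at_eq_iff)

lemma multigraph_pattern:
  assumes "m > 0" "finite V" "finite E" "\<And>e. e \<in> E \<Longrightarrow> incident m e \<subseteq> V"
  shows "multigraph (pattern m V E)"
  using assms incident_card by (simp add: multigraph_def)

lemma bipartite_pattern:
  assumes m: "m > 0" and E: "\<And>e. e \<in> E \<Longrightarrow> incident m e \<subseteq> V"
  shows "bipartite (pattern m V E)"
proof -
  \<comment> \<open>The white class: layers 1 and 2 of each period.\<close>
  define W where "W = {v \<in> V. v div m mod 4 \<in> {1, 2}}"
  have "\<exists>a\<in>W. \<exists>b\<in>V - W. incident m e = {a, b}" if "e \<in> E" for e
  proof -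
    define u where "u = vertex_at m (4 * period m e + lower (template e)) (column m e)"
    define v where "v = vertex_at m (4 * period m e + upper (template e)) (column m e + col_shift (template e))"
    have uv: "incident m e = {u, v}" by (simp add: incident_def u_def v_def)
    have "(u div m mod 4 \<in> {1, 2}) \<noteq> (v div m mod 4 \<in> {1, 2})"
      using colours_differ[OF template_less_14, of e] unfolding u_def v_def vertex_at_div[OF m] mod_mult_self4 .
    moreover have "u \<in> V" "v \<in> V" using E[OF that] uv by auto
    ultimately have "u \<in> W \<and> v \<in> V - W \<or> v \<in> W \<and> u \<in> V - W"
      unfolding W_def by blast
    then show ?thesis using uv by (metis insert_commute)
  qed
  then show ?thesis
    unfolding bipartite_def by (intro exI[of _ W] exI[of _ "V - W"]) (auto simp: W_def)
qed

lemma incident_bound: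
  assumes "m > 0" "e < 14 * m * k"
  shows "period m e < k" "incident m e \<subseteq> {..<m * (4 * k + 1)}"
proof -
  have "e div 14 < m * k" using assms by (simp add: less_mult_imp_div_less mult.assoc mult.commute)
  then show period: "period m e < k" unfolding period_def by (simp add: less_mult_imp_div_less mult.commute)
  have "vertex_at m (4 * period m e + t) c < m * (4 * k + 1)" if "t \<le> 4" for t c
  proof -
    have "nat (c mod int m) < m" using assms by (simp add: nat_less_iff)
    then have "vertex_at m (4 * period m e + t) c < m * (4 * period m e + t + 1)" by (simp add: vertex_at_def algebra_simps)
    also have "\<dots> \<le> m * (4 * k + 1)" using period that by (intro mult_le_mono2) linarith
    finally show ?thesis .
  qed
  moreover have "lower (template e) \<le> 4" "upper (template e) \<le> 4"
    using lower_less_upper[OF template_less_14, of e] upper_le_4[OF template_less_14, of e] by auto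
  ultimately show "incident m e \<subseteq> {..<m * (4 * k + 1)}"
    unfolding incident_def by auto
qed

section \<open>The two infinite families\<close>

lemma infinite_nonisomorphic_family:
  fixes G :: "nat \<Rightarrow> ('v, 'e) multigraph"
  assumes "inj (\<lambda>k. card (verts (G k)))"
  shows "infinite (range G)" "pairwise (\<lambda>G H. \<not> isomorphic G H) (range G)"
proof -
  have "inj G" using assms by (metis (mono_tags, lifting) injD injI)
  then show "infinite (range G)" by (simp add: range_inj_infinite)
  show "pairwise (\<lambda>G H. \<not> isomorphic G H) (range G)"
  proof (rule pairwiseI)
    fix A B assume "A \<in> range G" "B \<in> range G" "A \<noteq> B"
    then obtain k l where kl: "A = G k" "B = G l" "k \<noteq> l" by auto
    then have "card (verts A) \<noteq> card (verts B)" using assms by (auto dest: injD)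
    then show "\<not> isomorphic A B" unfolding isomorphic_def using bij_betw_same_card by blast
  qed
qed

text \<open>\<open>k + 1\<close> periods with two columns have \<open>8 * k + 10\<close> vertices
  and \<open>28 * k + 28\<close> edges; the edge with the largest number is left out.\<close>

definition multi_family :: "nat \<Rightarrow> (nat, nat) multigraph" where
  "multi_family k = pattern 2 {..<8 * k + 10} {..<28 * k + 27}"

lemma multi_family_properties:
  shows "multigraph (multi_family k)" "bipartite (multi_family k)" "k_planar 2 (multi_family k)"
    "card (verts (multi_family k)) = 8 * k + 10" "card (edges (multi_family k)) = 28 * k + 27"
proof -
  have E: "incident 2 e \<subseteq> {..<8 * k + 10}" "period 2 e < Suc k" if "e \<in> {..<28 * k + 27}" for e
    using incident_bound[of 2 e "Suc k"] that by auto
  show "multigraph (multi_family k)" "bipartite (multi_family k)"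
    unfolding multi_family_def using E by (auto intro!: multigraph_pattern bipartite_pattern)
  show "card (verts (multi_family k)) = 8 * k + 10" "card (edges (multi_family k)) = 28 * k + 27"
    by (simp_all add: multi_family_def)
  have "no_homotopic_edges (multi_family k) (vertex_pos 2) (curve 2)"
    unfolding multi_family_def using E(2) by (intro no_homotopic_edges_pattern_2) (force simp: less_Suc_eq_le)
  then show "k_planar 2 (multi_family k)"
    unfolding k_planar_def multi_family_def
    by (intro exI[of _ "vertex_pos 2"] exI[of _ "curve 2"] conjI ballI topological_drawing_pattern
        crossings_pattern[THEN conjunct1] crossings_pattern[THEN conjunct2]) simp_all
qed

text \<open>The deleted edges are those at the vertex \<open>12 k + 14\<close>.\<close>

definition simple_family :: "nat \<Rightarrow> (nat, nat) multigraph" where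
  "simple_family k = pattern 3 {..<12 * k + 14} ({..<42 * k + 42} - (\<lambda>r. 42 * k + r) ` {11, 24, 27, 37, 40})"

lemma last_vertex_incident:
  assumes e: "e < 42 * k + 42" "12 * k + 14 \<in> incident 3 e"
  shows "e \<in> (\<lambda>r. 42 * k + r) ` {11, 24, 27, 37, 40}"
proof -
  have b: "period 3 e < Suc k" using incident_bound(1)[of 3 e "Suc k"] e by simp
  have t: "lower (template e) < upper (template e)" "upper (template e) \<le> 4" using lower_less_upper upper_le_4 template_less_14 by auto
  \<comment> \<open>The vertex in column 2 of the last layer.\<close>
  have v: "12 * k + 14 = vertex_at 3 (4 * k + 4) 2" by (simp add: vertex_at_def)
  \<comment> \<open>It can only be the upper end of an edge: lower ends lie in layers below
    \<open>4 * k + 4\<close>.\<close>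
  have "4 * period 3 e + upper (template e) = 4 * k + 4 \<and> (int (column 3 e) + col_shift (template e)) mod 3 = 2"
    using e(2) b t unfolding incident_def v by (auto simp: vertex_at_eq_iff)
  then have *: "period 3 e = k" "upper (template e) = 4" "(int (column 3 e) + col_shift (template e)) mod 3 = 2"
    using b t by linarith+
  have "e = 14 * (e div 14) + template e" "e div 14 = 3 * k + column 3 e"
    using *(1) by (auto simp: period_def column_def template_def)
  then have 1: "e = 42 * k + (14 * column 3 e + template e)" by linarith
  have "\<forall>c\<in>set [0..<3]. \<forall>j\<in>set [0..<14]. upper j = 4 \<and> (int c + col_shift j) mod 3 = 2 \<longrightarrow> 14 * c + j \<in> {11, 24, 27, 37, 40}"
    by code_simp
  moreover have "column 3 e \<in> set [0..<3]" "template e \<in> set [0..<14]" using template_less_14 by (auto simp: column_def)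
  ultimately show ?thesis using * 1 by (metis imageI)
qed

lemma simple_family_properties:
  shows "simple_graph (simple_family k)" "bipartite (simple_family k)" "k_planar 2 (simple_family k)"
    "card (verts (simple_family k)) = 12 * k + 14" "card (edges (simple_family k)) = 42 * k + 37"
proof -
  \<comment> \<open>\<open>k + 1\<close> periods with three columns have \<open>12 * k + 15\<close>
    vertices and \<open>42 * k + 42\<close> edges, from which one vertex and five edges are
    removed.\<close>
  let ?E = "{..<42 * k + 42} - (\<lambda>r. 42 * k + r) ` {11, 24, 27, 37, 40}"
  have E: "incident 3 e \<subseteq> {..<12 * k + 14}" if "e \<in> ?E" for e
  proof -
    have "incident 3 e \<subseteq> {..<12 * k + 15}" using incident_bound(2)[of 3 e "Suc k"] that by auto
    moreover have "12 * k + 14 \<notin> incident 3 e" using last_vertex_incident that by blast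
    ultimately have "incident 3 e \<subseteq> {..<12 * k + 15} - {12 * k + 14}" by blast
    then show ?thesis by force
  qed
  have inj: "inj_on (incident 3) ?E" using incident_inj[of 3] by (auto intro: inj_on_subset)
  show "simple_graph (simple_family k)" "bipartite (simple_family k)"
    unfolding simple_family_def simple_graph_def using E inj
    by (auto intro!: multigraph_pattern bipartite_pattern)
  have "card ?E = card {..<42 * k + 42} - card ((\<lambda>r. 42 * k + r) ` {11, 24, 27, 37, 40::nat})"
    by (rule card_Diff_subset) auto
  also have "card ((\<lambda>r. 42 * k + r) ` {11, 24, 27, 37, 40::nat}) = 5"
    by (subst card_image) auto
  finally show "card (edges (simple_family k)) = 42 * k + 37" by (simp add: simple_family_def)
  show "card (verts (simple_family k)) = 12 * k + 14" by (simp add: simple_family_def)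
  \<comment> \<open>This holds vacuously, since no two edges are parallel.\<close>
  have "no_homotopic_edges (simple_family k) (vertex_pos 3) (curve 3)"
    unfolding no_homotopic_edges_def using inj by (auto simp: simple_family_def inj_on_eq_iff)
  then show "k_planar 2 (simple_family k)"
    unfolding k_planar_def simple_family_def
    by (intro exI[of _ "vertex_pos 3"] exI[of _ "curve 3"] conjI ballI topological_drawing_pattern
        crossings_pattern[THEN conjunct1] crossings_pattern[THEN conjunct2]) simp_all
qed

theorem theorem9:
  shows "(\<exists>\<G> :: (nat, nat) multigraph set. infinite \<G> \<and>
            pairwise (\<lambda>G H. \<not> isomorphic G H) \<G> \<and>
            (\<forall>G\<in>\<G>. simple_graph G \<and> bipartite G \<and> k_planar 2 G \<and>
               real (card (edges G)) = 7 / 2 * real (card (verts G)) - 12)) \<and>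
         (\<exists>\<G> :: (nat, nat) multigraph set. infinite \<G> \<and>
            pairwise (\<lambda>G H. \<not> isomorphic G H) \<G> \<and>
            (\<forall>G\<in>\<G>. multigraph G \<and> bipartite G \<and> k_planar 2 G \<and>
               real (card (edges G)) = 7 / 2 * real (card (verts G)) - 8))"
proof (intro conjI)
  have "inj (\<lambda>k. card (verts (simple_family k)))"
    by (simp add: simple_family_properties inj_def)
  from infinite_nonisomorphic_family[OF this]
  show "\<exists>\<G> :: (nat, nat) multigraph set. infinite \<G> \<and> pairwise (\<lambda>G H. \<not> isomorphic G H) \<G> \<and>
      (\<forall>G\<in>\<G>. simple_graph G \<and> bipartite G \<and> k_planar 2 G \<and>
         real (card (edges G)) = 7 / 2 * real (card (verts G)) - 12)"
    by (intro exI[of _ "range simple_family"]) (simp add: simple_family_properties)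
next
  have "inj (\<lambda>k. card (verts (multi_family k)))"
    by (simp add: multi_family_properties inj_def)
  from infinite_nonisomorphic_family[OF this]
  show "\<exists>\<G> :: (nat, nat) multigraph set. infinite \<G> \<and> pairwise (\<lambda>G H. \<not> isomorphic G H) \<G> \<and>
      (\<forall>G\<in>\<G>. multigraph G \<and> bipartite G \<and> k_planar 2 G \<and>
         real (card (edges G)) = 7 / 2 * real (card (verts G)) - 8)"
    by (intro exI[of _ "range multi_family"]) (simp add: multi_family_properties)
qed

end
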